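(* Let $(M,\varphi,\xi,\eta,g)$ be a 3-dimensional $\mathcal{F}_4$-manifold with associated metric $\widetilde g$, and let $C(t)$ be a Legendre $\varphi$-slant null curve with respect to $g$, i.e. a null curve for $g$ with $\eta(\dot C)=0$ and $g(\dot C,\varphi\dot C)=b$ constant. Then the curve $C$, considered with respect to $\widetilde g$ (and parameterized by its $\widetilde g$-arc length), is (i) spacelike if $b>0$, or timelike if $b<0$; (ii) a Legendre $\varphi$-slant curve; (iii) a geodesic.
   Context: A 3-dimensional almost contact B-metric manifold $(M,\varphi,\xi,\eta,g)$ is a smooth 3-manifold with a $(1,1)$-tensor field $\varphi$, a vector field $\xi$, a 1-form $\eta$ and a semi-Riemannian metric $g$ such that $\varphi^2X=-X+\eta(X)\xi$, $\eta(\xi)=1$, and $g(\varphi X,\varphi Y)=-g(X,Y)+\eta(X)\eta(Y)$. Consequently $\eta\circ\varphi=0$, $\varphi\xi=0$, $\eta(X)=g(X,\xi)$, $g(\xi,\xi)=1$, and $g$ has signature $(2,1)$. The associated metric $\widetilde g(X,Y)=g(X,\varphi Y)+\eta(X)\eta(Y)$ is also a B-metric for $(\varphi,\xi,\eta)$, of signature $(2,1)$. Let $\nabla$, $\widetilde\nabla$ be the Levi-Civita connections of $g$, $\widetilde g$. Put $F(X,Y,Z)=g((\nabla_X\varphi)Y,Z)$ and $\theta(X)=g^{ij}F(e_i,e_j,X)$ for a local basis $\{e_i\}$, where $(g^{ij})$ is the inverse of $(g(e_i,e_j))$. $M$ is an $\mathcal{F}_4$-manifold if $$F(X,Y,Z)=-\tfrac{\theta(\xi)}{2}\{g(\varphi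 X,\varphi Y)\eta(Z)+g(\varphi X,\varphi Z)\eta(Y)\}.$$ It is known that on a 3-dimensional $\mathcal{F}_4$-manifold $\nabla_X\xi=\tfrac{\theta(\xi)}{2}\varphi X$ and $\widetilde\nabla_XY-\nabla_XY=\tfrac{\theta(\xi)}{2}\{g(X,\varphi Y)-g(\varphi X,\varphi Y)\}\xi$. A smooth curve $C(t)$ is null for $g$ if $g(\dot C,\dot C)=0$ and $\dot C\neq0$ everywhere. For a B-metric $G\in\{g,\widetilde g\}$, a (suitably parameterized) curve is $\varphi$-slant with respect to $G$ if $G(\dot C,\xi)=\eta(\dot C)$ and $G(\dot C,\varphi\dot C)$ are constant, and Legendre if $\eta(\dot C)=0$; for non-null curves this is required for the $G$-arc length parameterization. A unit speed curve $C(\widetilde s)$, i.e. one with $\widetilde g(C',C')=\pm1$, $C'=dC/d\widetilde s$, is spacelike if $\widetilde g(C',C')=1$, timelike if $\widetilde g(C',C')=-1$, and a geodesic for $\widetilde g$ if $\widetilde\nabla_{C'}C'=0$. (For a Legendre $\varphi$-slant null curve in dimension 3 one has $b\neq0$.) *)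

theory Defs
  imports "HOL-Analysis.Analysis" "HOL-Library.Function_Algebras"
begin

text \<open>
  A tangent vector at a point is an operator on real functions, so that tangent spaces are
  subspaces of the function space below.
\<close>

instantiation "fun" :: (type, real_vector) real_vector
begin

definition "scaleR c f = (\<lambda>x. c *\<^sub>R f x)"

instance
  by standard (simp_all add: scaleR_fun_def fun_eq_iff scaleR_add_right scaleR_add_left)

end

definition linear_on_subspace ::
  "'v::real_vector set \<Rightarrow> ('v \<Rightarrow> 'w::real_vector) \<Rightarrow> bool" where
  "linear_on_subspace T L \<longleftrightarrow>
     (\<forall>v\<in>T. \<forall>w\<in>T. L (v + w) = L v + L w) \<and> (\<forall>c. \<forall>v\<in>T. L (c *\<^sub>R v) = c *\<^sub>R L v)"


section \<open>Smooth manifolds\<close>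

text \<open>\<open>Ck_on k S f\<close>: \<open>f\<close> is of class \<open>C\<^sup>k\<close> on \<open>S\<close>; used for open \<open>S\<close> in finite dimension only.\<close>

fun Ck_on ::
  "nat \<Rightarrow> 'v::real_normed_vector set \<Rightarrow> ('v \<Rightarrow> 'w::real_normed_vector) \<Rightarrow> bool" where
  "Ck_on 0 S f \<longleftrightarrow> continuous_on S f"
| "Ck_on (Suc k) S f \<longleftrightarrow>
     (\<forall>x\<in>S. f differentiable (at x)) \<and> (\<forall>v. Ck_on k S (\<lambda>x. frechet_derivative f (at x) v))"

definition smooth_on ::
  "'v::real_normed_vector set \<Rightarrow> ('v \<Rightarrow> 'w::real_normed_vector) \<Rightarrow> bool" where
  "smooth_on S f \<longleftrightarrow> (\<forall>k. Ck_on k S f)"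

text \<open>A chart is a pair of its domain and its coordinate map; values outside the domain are junk.\<close>

type_synonym ('a, 'n) chart = "'a set \<times> ('a \<Rightarrow> real ^ 'n)"

record ('a, 'n) manifold =
  mtop :: "'a topology"
  atlas :: "('a, 'n) chart set"

abbreviation points :: "('a, 'n) manifold \<Rightarrow> 'a set" where
  "points M \<equiv> topspace (mtop M)"

definition smooth_manifold :: "('a, 'n::finite) manifold \<Rightarrow> bool" where
  "smooth_manifold M \<longleftrightarrow>
     Hausdorff_space (mtop M) \<and> second_countable (mtop M) \<and>
     (\<Union>(D, \<psi>)\<in>atlas M. D) = points M \<and>
     (\<forall>(D, \<psi>)\<in>atlas M. openin (mtop M) D \<and> open (\<psi> ` D) \<and>
        homeomorphic_map (subtopology (mtop M) D) (top_of_set (\<psi> ` D)) \<psi>) \<and>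
     (\<forall>(D, \<psi>)\<in>atlas M. \<forall>(D', \<psi>')\<in>atlas M.
        smooth_on (\<psi> ` (D \<inter> D')) (\<psi>' \<circ> inv_into D \<psi>))"

definition smooth_fun_on :: "('a, 'n::finite) manifold \<Rightarrow> 'a set \<Rightarrow> ('a \<Rightarrow> real) \<Rightarrow> bool" where
  "smooth_fun_on M U f \<longleftrightarrow>
     (\<forall>(D, \<psi>)\<in>atlas M. smooth_on (\<psi> ` (D \<inter> U)) (f \<circ> inv_into D \<psi>))"

definition smooth_near :: "('a, 'n::finite) manifold \<Rightarrow> 'a \<Rightarrow> ('a \<Rightarrow> real) \<Rightarrow> bool" where
  "smooth_near M p f \<longleftrightarrow> (\<exists>U. openin (mtop M) U \<and> p \<in> U \<and> smooth_fun_on M U f)"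

definition smooth_curve :: "('a, 'n::finite) manifold \<Rightarrow> real set \<Rightarrow> (real \<Rightarrow> 'a) \<Rightarrow> bool" where
  "smooth_curve M I C \<longleftrightarrow>
     open I \<and> is_interval I \<and> I \<noteq> {} \<and>
     continuous_map (top_of_set I) (mtop M) C \<and>
     (\<forall>(D, \<psi>)\<in>atlas M. smooth_on {t \<in> I. C t \<in> D} (\<psi> \<circ> C))"


section \<open>Tangent vectors and vector fields\<close>

type_synonym 'a tvec = "('a \<Rightarrow> real) \<Rightarrow> real"

type_synonym 'a vfield = "'a \<Rightarrow> 'a tvec"

text \<open>
  A tangent vector at \<open>p\<close> is the operator \<open>f \<mapsto> (f \<circ> \<gamma>)'(0)\<close> on functions smooth near \<open>p\<close> for some
  smooth curve \<open>\<gamma>\<close> with \<open>\<gamma> 0 = p\<close>. It is set to \<open>0\<close> on the other functions, so that equality of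
  operators is equality of tangent vectors.
\<close>

definition velocity :: "('a, 'n::finite) manifold \<Rightarrow> (real \<Rightarrow> 'a) \<Rightarrow> real \<Rightarrow> 'a tvec" where
  "velocity M C t = (\<lambda>f. if smooth_near M (C t) f then deriv (\<lambda>s. f (C s)) t else 0)"

definition tangent_space :: "('a, 'n::finite) manifold \<Rightarrow> 'a \<Rightarrow> 'a tvec set" where
  "tangent_space M p = {velocity M \<gamma> 0 | \<gamma>. \<exists>I. smooth_curve M I \<gamma> \<and> 0 \<in> I \<and> \<gamma> 0 = p}"

definition smooth_vfield_on :: "('a, 'n::finite) manifold \<Rightarrow> 'a set \<Rightarrow> 'a vfield \<Rightarrow> bool" where
  "smooth_vfield_on M U X \<longleftrightarrow>
     (\<forall>p\<in>U. X p \<in> tangent_space M p) \<and>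
     (\<forall>V f. openin (mtop M) V \<and> V \<subseteq> U \<and> smooth_fun_on M V f \<longrightarrow>
        smooth_fun_on M V (\<lambda>p. X p f))"

definition coord_field ::
  "('a, 'n::finite) manifold \<Rightarrow> ('a, 'n) chart \<Rightarrow> 'n \<Rightarrow> 'a vfield" where
  "coord_field M c i p =
     (\<lambda>f. if smooth_near M p f
          then frechet_derivative (f \<circ> inv_into (fst c) (snd c)) (at (snd c p)) (axis i 1)
          else 0)"

definition local_frame ::
  "('a, 'n::finite) manifold \<Rightarrow> 'a set \<Rightarrow> ('n \<Rightarrow> 'a vfield) \<Rightarrow> bool" where
  "local_frame M U e \<longleftrightarrow>
     (\<forall>i. smooth_vfield_on M U (e i)) \<and>
     (\<forall>p\<in>U. inj (\<lambda>i. e i p) \<and> independent (range (\<lambda>i. e i p)) \<and>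
        span (range (\<lambda>i. e i p)) = tangent_space M p)"


section \<open>Tensor fields\<close>

definition one_form :: "('a, 'n::finite) manifold \<Rightarrow> ('a \<Rightarrow> 'a tvec \<Rightarrow> real) \<Rightarrow> bool" where
  "one_form M \<eta> \<longleftrightarrow>
     (\<forall>p\<in>points M. linear_on_subspace (tangent_space M p) (\<eta> p)) \<and>
     (\<forall>U X. openin (mtop M) U \<and> smooth_vfield_on M U X \<longrightarrow>
        smooth_fun_on M U (\<lambda>p. \<eta> p (X p)))"

definition tensor11 :: "('a, 'n::finite) manifold \<Rightarrow> ('a \<Rightarrow> 'a tvec \<Rightarrow> 'a tvec) \<Rightarrow> bool" where
  "tensor11 M \<phi> \<longleftrightarrow>
     (\<forall>p\<in>points M. linear_on_subspace (tangent_space M p) (\<phi> p) \<and>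
        \<phi> p ` tangent_space M p \<subseteq> tangent_space M p) \<and>
     (\<forall>U X. openin (mtop M) U \<and> smooth_vfield_on M U X \<longrightarrow>
        smooth_vfield_on M U (\<lambda>p. \<phi> p (X p)))"

definition tensor02 ::
  "('a, 'n::finite) manifold \<Rightarrow> ('a \<Rightarrow> 'a tvec \<Rightarrow> 'a tvec \<Rightarrow> real) \<Rightarrow> bool" where
  "tensor02 M g \<longleftrightarrow>
     (\<forall>p\<in>points M. \<forall>v\<in>tangent_space M p.
        linear_on_subspace (tangent_space M p) (g p v) \<and>
        linear_on_subspace (tangent_space M p) (\<lambda>w. g p w v)) \<and>
     (\<forall>U X Y. openin (mtop M) U \<and> smooth_vfield_on M U X \<and> smooth_vfield_on M U Y \<longrightarrow>
        smooth_fun_on M U (\<lambda>p. g p (X p) (Y p)))"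

definition metric_index ::
  "('a, 'n::finite) manifold \<Rightarrow> ('a \<Rightarrow> 'a tvec \<Rightarrow> 'a tvec \<Rightarrow> real) \<Rightarrow> 'a \<Rightarrow> nat" where
  "metric_index M g p =
     Max {dim W | W. subspace W \<and> W \<subseteq> tangent_space M p \<and> (\<forall>w\<in>W. w \<noteq> 0 \<longrightarrow> g p w w < 0)}"

definition semi_riemannian_metric ::
  "('a, 'n::finite) manifold \<Rightarrow> ('a \<Rightarrow> 'a tvec \<Rightarrow> 'a tvec \<Rightarrow> real) \<Rightarrow> bool" where
  "semi_riemannian_metric M g \<longleftrightarrow>
     tensor02 M g \<and>
     (\<forall>p\<in>points M. \<forall>v\<in>tangent_space M p. \<forall>w\<in>tangent_space M p. g p v w = g p w v) \<and>
     (\<forall>p\<in>points M. \<forall>v\<in>tangent_space M p. (\<forall>w\<in>tangent_space M p. g p v w = 0) \<longrightarrow> v = 0) \<and>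
     (\<exists>k. \<forall>p\<in>points M. metric_index M g p = k)"


section \<open>Connections\<close>

text \<open>
  \<open>nabla p v Y\<close> is the derivative at \<open>p\<close> in the direction \<open>v\<close> of a vector field \<open>Y\<close> that is smooth
  in some neighbourhood of \<open>p\<close>; by the locality clause it depends only on the germ of \<open>Y\<close> at \<open>p\<close>.
\<close>

type_synonym 'a connection = "'a \<Rightarrow> 'a tvec \<Rightarrow> 'a vfield \<Rightarrow> 'a tvec"

definition affine_connection :: "('a, 'n::finite) manifold \<Rightarrow> 'a connection \<Rightarrow> bool" where
  "affine_connection M nabla \<longleftrightarrow>
     (\<forall>U Y. openin (mtop M) U \<and> smooth_vfield_on M U Y \<longrightarrow>
        (\<forall>p\<in>U. linear_on_subspace (tangent_space M p) (\<lambda>v. nabla p v Y)) \<and>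
        (\<forall>X. smooth_vfield_on M U X \<longrightarrow> smooth_vfield_on M U (\<lambda>p. nabla p (X p) Y)) \<and>
        (\<forall>p\<in>U. \<forall>v\<in>tangent_space M p.
           nabla p v Y \<in> tangent_space M p \<and>
           (\<forall>Z. smooth_vfield_on M U Z \<longrightarrow>
              nabla p v (\<lambda>q. Y q + Z q) = nabla p v Y + nabla p v Z) \<and>
           (\<forall>f. smooth_fun_on M U f \<longrightarrow>
              nabla p v (\<lambda>q. f q *\<^sub>R Y q) = v f *\<^sub>R Y p + f p *\<^sub>R nabla p v Y) \<and>
           (\<forall>Z. (\<forall>q\<in>U. Z q = Y q) \<longrightarrow> nabla p v Z = nabla p v Y)))"

text \<open>The second clause says \<open>\<nabla>\<^sub>X Y - \<nabla>\<^sub>Y X = [X, Y]\<close>, with \<open>[X, Y] f = X (Y f) - Y (X f)\<close>.\<close>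

definition levi_civita ::
  "('a, 'n::finite) manifold \<Rightarrow> ('a \<Rightarrow> 'a tvec \<Rightarrow> 'a tvec \<Rightarrow> real) \<Rightarrow> 'a connection \<Rightarrow> bool" where
  "levi_civita M g nabla \<longleftrightarrow>
     affine_connection M nabla \<and>
     (\<forall>U X Y f. openin (mtop M) U \<and> smooth_vfield_on M U X \<and> smooth_vfield_on M U Y \<and>
        smooth_fun_on M U f \<longrightarrow>
        (\<forall>p\<in>U. nabla p (X p) Y f - nabla p (Y p) X f
           = X p (\<lambda>q. Y q f) - Y p (\<lambda>q. X q f))) \<and>
     (\<forall>U X Y Z. openin (mtop M) U \<and> smooth_vfield_on M U X \<and> smooth_vfield_on M U Y \<and>
        smooth_vfield_on M U Z \<longrightarrow>
        (\<forall>p\<in>U. X p (\<lambda>q. g q (Y q) (Z q))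
           = g p (nabla p (X p) Y) (Z p) + g p (Y p) (nabla p (X p) Z)))"

text \<open>
  The covariant derivative \<open>DV/dt\<close> of a vector field \<open>V\<close> along a curve, written in a chart
  with coordinates \<open>x\<^sup>i\<close> around \<open>C t\<close>:
  if \<open>V = \<Sum>\<^sub>i V\<^sup>i \<partial>\<^sub>i\<close> with \<open>V\<^sup>i = V(x\<^sup>i)\<close>, then \<open>DV/dt = \<Sum>\<^sub>i (V\<^sup>i)' \<partial>\<^sub>i + V\<^sup>i \<nabla>\<^sub>C\<^sub>' \<partial>\<^sub>i\<close>.
\<close>

definition cov_deriv_along ::
  "('a, 'n::finite) manifold \<Rightarrow> 'a connection \<Rightarrow> ('a, 'n) chart \<Rightarrow>
     (real \<Rightarrow> 'a) \<Rightarrow> (real \<Rightarrow> 'a tvec) \<Rightarrow> real \<Rightarrow> 'a tvec" where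
  "cov_deriv_along M nabla c C V t =
     (\<Sum>i\<in>UNIV. deriv (\<lambda>s. V s (\<lambda>q. snd c q $ i)) t *\<^sub>R coord_field M c i (C t)
        + V t (\<lambda>q. snd c q $ i) *\<^sub>R nabla (C t) (velocity M C t) (coord_field M c i))"

definition geodesic ::
  "('a, 'n::finite) manifold \<Rightarrow> 'a connection \<Rightarrow> real set \<Rightarrow> (real \<Rightarrow> 'a) \<Rightarrow> bool" where
  "geodesic M nabla I C \<longleftrightarrow>
     smooth_curve M I C \<and>
     (\<forall>t\<in>I. \<forall>c\<in>atlas M. C t \<in> fst c \<longrightarrow> cov_deriv_along M nabla c C (velocity M C) t = 0)"


section \<open>Almost contact B-metric manifolds\<close>

definition almost_contact_B_metric_manifold ::
  "('a, 3) manifold \<Rightarrow> ('a \<Rightarrow> 'a tvec \<Rightarrow> 'a tvec) \<Rightarrow> 'a vfield \<Rightarrow> ('a \<Rightarrow> 'a tvec \<Rightarrow> real) \<Rightarrow>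
     ('a \<Rightarrow> 'a tvec \<Rightarrow> 'a tvec \<Rightarrow> real) \<Rightarrow> bool" where
  "almost_contact_B_metric_manifold M \<phi> \<xi> \<eta> g \<longleftrightarrow>
     smooth_manifold M \<and> tensor11 M \<phi> \<and> smooth_vfield_on M (points M) \<xi> \<and> one_form M \<eta> \<and>
     semi_riemannian_metric M g \<and>
     (\<forall>p\<in>points M.
        \<eta> p (\<xi> p) = 1 \<and>
        (\<forall>v\<in>tangent_space M p. \<phi> p (\<phi> p v) = - v + \<eta> p v *\<^sub>R \<xi> p) \<and>
        (\<forall>v\<in>tangent_space M p. \<forall>w\<in>tangent_space M p.
           g p (\<phi> p v) (\<phi> p w) = - g p v w + \<eta> p v * \<eta> p w))"

definition associated_metric ::
  "('a \<Rightarrow> 'a tvec \<Rightarrow> 'a tvec) \<Rightarrow> ('a \<Rightarrow> 'a tvec \<Rightarrow> real) \<Rightarrow>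
     ('a \<Rightarrow> 'a tvec \<Rightarrow> 'a tvec \<Rightarrow> real) \<Rightarrow> 'a \<Rightarrow> 'a tvec \<Rightarrow> 'a tvec \<Rightarrow> real" where
  "associated_metric \<phi> \<eta> g p v w = g p v (\<phi> p w) + \<eta> p v * \<eta> p w"

text \<open>\<open>(\<nabla>\<^sub>X \<phi>) Y = \<nabla>\<^sub>X (\<phi> Y) - \<phi> (\<nabla>\<^sub>X Y)\<close>\<close>

definition fundamental_F ::
  "('a \<Rightarrow> 'a tvec \<Rightarrow> 'a tvec) \<Rightarrow> ('a \<Rightarrow> 'a tvec \<Rightarrow> 'a tvec \<Rightarrow> real) \<Rightarrow> 'a connection \<Rightarrow>
     'a vfield \<Rightarrow> 'a vfield \<Rightarrow> 'a vfield \<Rightarrow> 'a \<Rightarrow> real" where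
  "fundamental_F \<phi> g nabla X Y Z p =
     g p (nabla p (X p) (\<lambda>q. \<phi> q (Y q)) - \<phi> p (nabla p (X p) Y)) (Z p)"

text \<open>\<open>\<theta>(X) = g\<^sup>i\<^sup>j F(e\<^sub>i, e\<^sub>j, X)\<close>; the value does not depend on the local frame \<open>e\<close>.\<close>

definition lee_theta ::
  "('a \<Rightarrow> 'a tvec \<Rightarrow> 'a tvec) \<Rightarrow> ('a \<Rightarrow> 'a tvec \<Rightarrow> 'a tvec \<Rightarrow> real) \<Rightarrow> 'a connection \<Rightarrow>
     (3 \<Rightarrow> 'a vfield) \<Rightarrow> 'a vfield \<Rightarrow> 'a \<Rightarrow> real" where
  "lee_theta \<phi> g nabla e X p =
     (\<Sum>i\<in>UNIV. \<Sum>j\<in>UNIV.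
        matrix_inv (\<chi> k l. g p (e k p) (e l p)) $ i $ j *
        fundamental_F \<phi> g nabla (e i) (e j) X p)"

text \<open>Here \<open>nabla\<close> is meant to be the Levi-Civita connection of \<open>g\<close>.\<close>

definition F4_condition ::
  "('a, 3) manifold \<Rightarrow> ('a \<Rightarrow> 'a tvec \<Rightarrow> 'a tvec) \<Rightarrow> 'a vfield \<Rightarrow> ('a \<Rightarrow> 'a tvec \<Rightarrow> real) \<Rightarrow>
     ('a \<Rightarrow> 'a tvec \<Rightarrow> 'a tvec \<Rightarrow> real) \<Rightarrow> 'a connection \<Rightarrow> bool" where
  "F4_condition M \<phi> \<xi> \<eta> g nabla \<longleftrightarrow>
     (\<forall>U e X Y Z. openin (mtop M) U \<and> local_frame M U e \<and>
        smooth_vfield_on M U X \<and> smooth_vfield_on M U Y \<and> smooth_vfield_on M U Z \<longrightarrow>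
        (\<forall>p\<in>U. fundamental_F \<phi> g nabla X Y Z p =
           - (lee_theta \<phi> g nabla e \<xi> p / 2) *
             (g p (\<phi> p (X p)) (\<phi> p (Y p)) * \<eta> p (Z p) +
              g p (\<phi> p (X p)) (\<phi> p (Z p)) * \<eta> p (Y p))))"


section \<open>Curves\<close>

definition null_curve ::
  "('a, 3) manifold \<Rightarrow> ('a \<Rightarrow> 'a tvec \<Rightarrow> 'a tvec \<Rightarrow> real) \<Rightarrow> real set \<Rightarrow> (real \<Rightarrow> 'a) \<Rightarrow> bool" where
  "null_curve M G I C \<longleftrightarrow>
     smooth_curve M I C \<and>
     (\<forall>t\<in>I. G (C t) (velocity M C t) (velocity M C t) = 0 \<and> velocity M C t \<noteq> 0)"

definition legendre_curve ::
  "('a, 3) manifold \<Rightarrow> ('a \<Rightarrow> 'a tvec \<Rightarrow> real) \<Rightarrow> real set \<Rightarrow> (real \<Rightarrow> 'a) \<Rightarrow> bool" where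
  "legendre_curve M \<eta> I C \<longleftrightarrow> (\<forall>t\<in>I. \<eta> (C t) (velocity M C t) = 0)"

text \<open>
  \<open>a\<close> and \<open>b\<close> are the two constants of the curve. For a non-null curve the predicate is
  meant to be applied to its arc length parameterization.
\<close>

definition phi_slant_curve ::
  "('a, 3) manifold \<Rightarrow> ('a \<Rightarrow> 'a tvec \<Rightarrow> 'a tvec) \<Rightarrow> 'a vfield \<Rightarrow> ('a \<Rightarrow> 'a tvec \<Rightarrow> real) \<Rightarrow>
     ('a \<Rightarrow> 'a tvec \<Rightarrow> 'a tvec \<Rightarrow> real) \<Rightarrow> real set \<Rightarrow> (real \<Rightarrow> 'a) \<Rightarrow> real \<Rightarrow> real \<Rightarrow> bool" where
  "phi_slant_curve M \<phi> \<xi> \<eta> G I C a b \<longleftrightarrow>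
     (\<forall>t\<in>I. G (C t) (velocity M C t) (\<xi> (C t)) = a \<and>
        \<eta> (C t) (velocity M C t) = a \<and>
        G (C t) (velocity M C t) (\<phi> (C t) (velocity M C t)) = b)"

definition spacelike_unit_curve ::
  "('a, 3) manifold \<Rightarrow> ('a \<Rightarrow> 'a tvec \<Rightarrow> 'a tvec \<Rightarrow> real) \<Rightarrow> real set \<Rightarrow> (real \<Rightarrow> 'a) \<Rightarrow> bool" where
  "spacelike_unit_curve M G I C \<longleftrightarrow>
     smooth_curve M I C \<and> (\<forall>t\<in>I. G (C t) (velocity M C t) (velocity M C t) = 1)"

definition timelike_unit_curve ::
  "('a, 3) manifold \<Rightarrow> ('a \<Rightarrow> 'a tvec \<Rightarrow> 'a tvec \<Rightarrow> real) \<Rightarrow> real set \<Rightarrow> (real \<Rightarrow> 'a) \<Rightarrow> bool" where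
  "timelike_unit_curve M G I C \<longleftrightarrow>
     smooth_curve M I C \<and> (\<forall>t\<in>I. G (C t) (velocity M C t) (velocity M C t) = -1)"

definition unit_speed_curve ::
  "('a, 3) manifold \<Rightarrow> ('a \<Rightarrow> 'a tvec \<Rightarrow> 'a tvec \<Rightarrow> real) \<Rightarrow> real set \<Rightarrow> (real \<Rightarrow> 'a) \<Rightarrow> bool" where
  "unit_speed_curve M G I C \<longleftrightarrow>
     smooth_curve M I C \<and> (\<forall>t\<in>I. \<bar>G (C t) (velocity M C t) (velocity M C t)\<bar> = 1)"

text \<open>\<open>t = h s\<close> is a change of parameter turning \<open>C\<close> into the unit speed curve \<open>s \<mapsto> C (h s)\<close>.\<close>

definition arc_length_reparam ::
  "('a, 3) manifold \<Rightarrow> ('a \<Rightarrow> 'a tvec \<Rightarrow> 'a tvec \<Rightarrow> real) \<Rightarrow> real set \<Rightarrow> (real \<Rightarrow> 'a) \<Rightarrow>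
     real set \<Rightarrow> (real \<Rightarrow> real) \<Rightarrow> bool" where
  "arc_length_reparam M G I C J h \<longleftrightarrow>
     open J \<and> is_interval J \<and> bij_betw h J I \<and> smooth_on J h \<and> (\<forall>s\<in>J. deriv h s > 0) \<and>
     unit_speed_curve M G J (C \<circ> h)"

end

theory Submission
  imports Defs
begin

text \<open>
  Write \<open>G\<close> for the associated metric and \<open>V\<close> for the velocity of a null Legendre curve with
  \<open>g(V, \<phi> V) = b\<close>. Since \<open>V\<close>, \<open>\<phi> V\<close>, \<open>\<xi>\<close> span the tangent space, \<open>b = 0\<close> would put \<open>V\<close> into the
  kernel of \<open>g\<close>. As \<open>G(V, V) = b\<close>, the arc length parameter is an affine function of the given one,
  and it only remains to show that \<open>\<nabla>'\<^sub>V V = 0\<close>.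

  Differentiating \<open>g(V, V)\<close>, \<open>g(V, \<phi> V)\<close> and \<open>\<eta>(V)\<close> along the curve, with \<open>\<nabla>\<phi>\<close> and \<open>\<nabla>\<xi>\<close> known from the
  condition on \<open>F\<close>, gives \<open>\<nabla>\<^sub>V V = - (\<theta>(\<xi>) b / 2) \<xi>\<close>. On the other hand, the derivative of \<open>G\<close> with respect
  to \<open>\<nabla>\<close> is a combination of values of \<open>F\<close>, and the Koszul argument yields
  \<open>\<nabla>'\<^sub>V V - \<nabla>\<^sub>V V = (\<theta>(\<xi>) b / 2) \<xi>\<close>.
\<close>

section \<open>Calculus of smooth maps\<close>

text \<open>The velocity V exists only along the curve, whereas \<open>nabla\<close> and
  \<open>nabla'\<close> act on fields over open sets. In a chart around \<open>C t\<close> the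
  components of V are therefore frozen at time \<open>t\<close>, which gives a field
  \<open>X\<close> with constant components and value V at \<open>C t\<close>. The covariant
  derivative of V is then \<open>accel C t\<close> plus the connection applied to \<open>X\<close>.
  The first summand involves no connection, so comparing the two acceleration vectors is a question
  about the single field \<open>X\<close> at one point. The price is that \<open>X\<close> is null
  and Legendre only at \<open>C t\<close>: the constancy of g(V, V), g(V, \<phi> V) and \<eta>(V)
  must be exploited for functions of the curve parameter, and the resulting derivatives are split
  afterwards into an \<open>accel\<close> part and the action of V on a function built from
  \<open>X\<close>. These three products suffice because on the kernel of \<eta> the map \<phi>
  squares to -1: in dimension 3 a vector orthogonal to V and \<phi> V has only a \<xi> component
  left, and \<eta> measures it.\<close>

lemma Ck_on_transform:
  assumes "open S" shows "Ck_on k S f \<Longrightarrow> (\<And>x. x \<in> S \<Longrightarrow> f x = g x) \<Longrightarrow> Ck_on k S g"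
proof (induction k arbitrary: f g)
  case 0
  then show ?case using continuous_on_cong[of S S f g] by simp
next
  case (Suc k)
  have D: "g differentiable at x \<and> frechet_derivative f (at x) = frechet_derivative g (at x)"
    if "x \<in> S" for x
  proof -
    have "(f has_derivative frechet_derivative f (at x)) (at x)"
      using Suc.prems(1) that by (simp flip: frechet_derivative_works)
    then have "(g has_derivative frechet_derivative f (at x)) (at x)"
      by (rule has_derivative_transform_within_open[OF _ assms that]) (simp add: Suc.prems(2))
    then show ?thesis
      by (auto simp: differentiable_def dest: frechet_derivative_at)
  qed
  have "Ck_on k S (\<lambda>x. frechet_derivative g (at x) v)" for v
    by (rule Suc.IH[of "\<lambda>x. frechet_derivative f (at x) v"]) (use Suc.prems(1) D in simp_all)
  then show ?case using D by simp
qed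

text \<open>Derivatives are unique on an open set, so an explicit formula \<open>f'\<close> may
  replace the chosen \<open>frechet_derivative\<close>. The rules for sums, products and
  compositions all take their induction step through this.\<close>

lemma Ck_on_SucI:
  assumes "open S" "\<And>x. x \<in> S \<Longrightarrow> (f has_derivative f' x) (at x)"
    and "\<And>v. Ck_on k S (\<lambda>x. f' x v)"
  shows "Ck_on (Suc k) S f"
proof -
  have "Ck_on k S (\<lambda>x. frechet_derivative f (at x) v)" for v
    using assms(3)[of v]
    by (rule Ck_on_transform[OF assms(1)]) (simp flip: frechet_derivative_at[OF assms(2)])
  then show ?thesis
    using assms(2) by (auto simp: differentiable_def)
qed

lemma Ck_on_Suc_has_derivative:
  "Ck_on (Suc k) S f \<Longrightarrow> x \<in> S \<Longrightarrow> (f has_derivative frechet_derivative f (at x)) (at x)"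
  by (simp flip: frechet_derivative_works)

lemma Ck_on_Suc_D:
  assumes "Ck_on (Suc k) S f"
  shows "x \<in> S \<Longrightarrow> f differentiable at x"
    and "Ck_on k S (\<lambda>x. frechet_derivative f (at x) v)"
  using assms by simp_all

lemma Ck_on_Suc_imp: "Ck_on (Suc k) S f \<Longrightarrow> Ck_on k S f"
proof (induction k arbitrary: f)
  case 0
  have "isCont f x" if "x \<in> S" for x
    using Ck_on_Suc_D(1)[OF 0 that] by (rule differentiable_imp_continuous_within)
  then show ?case by (simp add: continuous_at_imp_continuous_on)
next
  case (Suc k)
  have "Ck_on k S (\<lambda>x. frechet_derivative f (at x) v)" for v
    using Ck_on_Suc_D(2)[OF Suc.prems] by (rule Suc.IH)
  then show ?case using Ck_on_Suc_D(1)[OF Suc.prems] by simp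
qed

lemma Ck_on_subset: "Ck_on k S f \<Longrightarrow> T \<subseteq> S \<Longrightarrow> Ck_on k T f"
proof (induction k arbitrary: f)
  case 0
  then show ?case by (auto intro: continuous_on_subset)
next
  case (Suc k)
  have "Ck_on k T (\<lambda>x. frechet_derivative f (at x) v)" for v
    using Ck_on_Suc_D(2)[OF Suc.prems(1)] Suc.prems(2) by (rule Suc.IH)
  then show ?case using Ck_on_Suc_D(1)[OF Suc.prems(1)] Suc.prems(2) by auto
qed

lemma Ck_on_const: "open S \<Longrightarrow> Ck_on k S (\<lambda>x. c)"
proof (induction k arbitrary: c)
  case (Suc k)
  show ?case
    by (rule Ck_on_SucI[where f' = "\<lambda>x v. 0"]) (use Suc in simp_all)
qed simp

lemma Ck_on_linear:
  assumes "open S" "bounded_linear L" shows "Ck_on k S L"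
proof (cases k)
  case 0
  then show ?thesis using assms(2) by (simp add: linear_continuous_on)
next
  case (Suc j)
  show ?thesis
    unfolding Suc
    by (rule Ck_on_SucI[where f' = "\<lambda>x. L"]) (simp_all add: Ck_on_const assms bounded_linear_imp_has_derivative)
qed

lemma Ck_on_add:
  assumes "open S" shows "Ck_on k S f \<Longrightarrow> Ck_on k S g \<Longrightarrow> Ck_on k S (\<lambda>x. f x + g x)"
proof (induction k arbitrary: f g)
  case 0
  then show ?case by (simp add: continuous_on_add)
next
  case (Suc k)
  show ?case
  proof (rule Ck_on_SucI[OF assms])
    fix x assume "x \<in> S"
    show "((\<lambda>x. f x + g x) has_derivative
        (\<lambda>v. frechet_derivative f (at x) v + frechet_derivative g (at x) v)) (at x)"
      using Suc.prems[THEN Ck_on_Suc_has_derivative, OF \<open>x \<in> S\<close>] by (rule has_derivative_add)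
  next
    fix v
    show "Ck_on k S (\<lambda>x. frechet_derivative f (at x) v + frechet_derivative g (at x) v)"
      using Suc.prems[THEN Ck_on_Suc_D(2)] by (rule Suc.IH)
  qed
qed

lemma Ck_on_sum:
  assumes "open S" "\<And>i. i \<in> A \<Longrightarrow> Ck_on k S (f i)"
  shows "Ck_on k S (\<lambda>x. \<Sum>i\<in>A. f i x)"
  using assms(2)
  by (induction A rule: infinite_finite_induct) (simp_all add: Ck_on_const Ck_on_add assms(1))

lemma Ck_on_scaleR:
  fixes u :: "'a::real_normed_vector \<Rightarrow> real"
  assumes "open S" shows "Ck_on k S u \<Longrightarrow> Ck_on k S f \<Longrightarrow> Ck_on k S (\<lambda>x. u x *\<^sub>R f x)"
proof (induction k arbitrary: u f)
  case 0
  then show ?case by (simp add: continuous_on_scaleR)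
next
  case (Suc k)
  show ?case
  proof (rule Ck_on_SucI[OF assms])
    fix x assume "x \<in> S"
    show "((\<lambda>x. u x *\<^sub>R f x) has_derivative
        (\<lambda>v. u x *\<^sub>R frechet_derivative f (at x) v + frechet_derivative u (at x) v *\<^sub>R f x)) (at x)"
      using Suc.prems[THEN Ck_on_Suc_has_derivative, OF \<open>x \<in> S\<close>] by (rule has_derivative_scaleR)
  next
    fix v
    show "Ck_on k S
        (\<lambda>x. u x *\<^sub>R frechet_derivative f (at x) v + frechet_derivative u (at x) v *\<^sub>R f x)"
      by (intro Ck_on_add assms Suc.IH Suc.prems[THEN Ck_on_Suc_imp] Suc.prems[THEN Ck_on_Suc_D(2)])
  qed
qed

lemma Ck_on_bounded_linear:
  assumes "open S" "bounded_linear L" shows "Ck_on k S f \<Longrightarrow> Ck_on k S (\<lambda>x. L (f x))"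
proof (induction k arbitrary: f)
  case 0
  then show ?case using assms(2) by (simp add: bounded_linear.continuous_on)
next
  case (Suc k)
  show ?case
  proof (rule Ck_on_SucI[OF assms(1)])
    fix x assume "x \<in> S"
    show "((\<lambda>x. L (f x)) has_derivative (\<lambda>v. L (frechet_derivative f (at x) v))) (at x)"
      using Suc.prems[THEN Ck_on_Suc_has_derivative, OF \<open>x \<in> S\<close>]
      by (rule bounded_linear.has_derivative[OF assms(2)])
  next
    fix v
    show "Ck_on k S (\<lambda>x. L (frechet_derivative f (at x) v))"
      using Suc.prems[THEN Ck_on_Suc_D(2)] by (rule Suc.IH)
  qed
qed

text \<open>The chain rule composes linear maps, which does not match the recursion on directional
  derivatives. Expanding the inner derivative in the finite basis turns it into a finite sum of
  products; the induction varies only \<open>f\<close>, whose derivative is composed with the same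
  \<open>g\<close> one order lower.\<close>

lemma Ck_on_compose:
  fixes f :: "'b::euclidean_space \<Rightarrow> 'c::real_normed_vector" and g :: "'a::real_normed_vector \<Rightarrow> 'b"
  assumes "open S"
  shows "Ck_on k T f \<Longrightarrow> Ck_on k S g \<Longrightarrow> g ` S \<subseteq> T \<Longrightarrow> Ck_on k S (\<lambda>x. f (g x))"
proof (induction k arbitrary: f)
  case 0
  then show ?case using continuous_on_compose2[of T f S g] by simp
next
  case (Suc k)
  let ?D = "\<lambda>x v. \<Sum>b\<in>Basis. (frechet_derivative g (at x) v \<bullet> b) *\<^sub>R frechet_derivative f (at (g x)) b"
  show ?case
  proof (rule Ck_on_SucI[OF assms])
    fix x assume x: "x \<in> S"
    have g: "(g has_derivative frechet_derivative g (at x)) (at x)"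
      using Suc.prems(2) x by (rule Ck_on_Suc_has_derivative)
    have f: "(f has_derivative frechet_derivative f (at (g x))) (at (g x))"
      using Suc.prems(1) by (rule Ck_on_Suc_has_derivative) (use Suc.prems(3) x in auto)
    interpret linear "frechet_derivative f (at (g x))"
      by (rule has_derivative_linear[OF f])
    have eq: "frechet_derivative f (at (g x)) w
        = (\<Sum>b\<in>Basis. (w \<bullet> b) *\<^sub>R frechet_derivative f (at (g x)) b)" for w
      using sum[of "\<lambda>b. (w \<bullet> b) *\<^sub>R b" Basis] by (simp add: euclidean_representation scale)
    show "((\<lambda>x. f (g x)) has_derivative ?D x) (at x)"
      using has_derivative_compose[OF g f] by (subst eq[symmetric])
  next
    fix v
    show "Ck_on k S (\<lambda>x. ?D x v)"
    proof (intro Ck_on_sum Ck_on_scaleR assms)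
      fix b :: 'b
      show "Ck_on k S (\<lambda>x. frechet_derivative g (at x) v \<bullet> b)"
        by (intro Ck_on_bounded_linear[OF assms bounded_linear_inner_left] Ck_on_Suc_D(2)[OF Suc.prems(2)])
      show "Ck_on k S (\<lambda>x. frechet_derivative f (at (g x)) b)"
        by (rule Suc.IH[OF Ck_on_Suc_D(2)[OF Suc.prems(1)] Ck_on_Suc_imp[OF Suc.prems(2)] Suc.prems(3)])
    qed
  qed
qed

section \<open>Infinitely differentiable maps, order by order\<close>

lemma smooth_on_transform:
  "open S \<Longrightarrow> smooth_on S f \<Longrightarrow> (\<And>x. x \<in> S \<Longrightarrow> f x = g x) \<Longrightarrow> smooth_on S g"
  unfolding smooth_on_def using Ck_on_transform[of S _ f g] by auto

lemma smooth_on_subset: "smooth_on S f \<Longrightarrow> T \<subseteq> S \<Longrightarrow> smooth_on T f"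
  by (simp add: smooth_on_def Ck_on_subset[of _ S f T])

lemma smooth_on_const: "open S \<Longrightarrow> smooth_on S (\<lambda>x. c)"
  by (simp add: smooth_on_def Ck_on_const)

lemma smooth_on_linear: "open S \<Longrightarrow> bounded_linear L \<Longrightarrow> smooth_on S L"
  by (simp add: smooth_on_def Ck_on_linear)

lemma smooth_on_add:
  "open S \<Longrightarrow> smooth_on S f \<Longrightarrow> smooth_on S g \<Longrightarrow> smooth_on S (\<lambda>x. f x + g x)"
  by (simp add: smooth_on_def Ck_on_add)

lemma smooth_on_bounded_linear:
  "open S \<Longrightarrow> bounded_linear L \<Longrightarrow> smooth_on S f \<Longrightarrow> smooth_on S (\<lambda>x. L (f x))"
  by (simp add: smooth_on_def Ck_on_bounded_linear)

lemma smooth_on_compose: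
  fixes f :: "'b::euclidean_space \<Rightarrow> 'c::real_normed_vector"
  shows "open S \<Longrightarrow> smooth_on T f \<Longrightarrow> smooth_on S g \<Longrightarrow> g ` S \<subseteq> T \<Longrightarrow> smooth_on S (\<lambda>x. f (g x))"
  by (simp add: smooth_on_def Ck_on_compose[of S _ T f g])

lemma smooth_on_frechet_derivative:
  assumes "smooth_on S f" shows "smooth_on S (\<lambda>x. frechet_derivative f (at x) v)"
proof -
  have "Ck_on (Suc k) S f" for k using assms by (simp only: smooth_on_def)
  then show ?thesis using Ck_on_Suc_D(2) by (auto simp: smooth_on_def)
qed

lemma smooth_on_differentiable:
  assumes "smooth_on S f" "x \<in> S" shows "f differentiable at x"
proof -
  have "Ck_on (Suc 0) S f" using assms by (simp only: smooth_on_def)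
  then show ?thesis using assms(2) by (rule Ck_on_Suc_D(1))
qed

section \<open>Charts and tangent spaces\<close>

lemma sum_fun_apply: "(\<Sum>i\<in>A. F i) x = (\<Sum>i\<in>A. F i x)"
  by (induction A rule: infinite_finite_induct) simp_all

lemma scaleR_fun_apply [simp]: "(c *\<^sub>R f) x = c *\<^sub>R f x"
  by (simp add: scaleR_fun_def)

lemma smooth_fun_on_subset: "smooth_fun_on M U f \<Longrightarrow> V \<subseteq> U \<Longrightarrow> smooth_fun_on M V f"
  unfolding smooth_fun_on_def by (fastforce intro: smooth_on_subset)

lemma smooth_vfield_on_subset: "smooth_vfield_on M U X \<Longrightarrow> V \<subseteq> U \<Longrightarrow> smooth_vfield_on M V X"
  unfolding smooth_vfield_on_def by blast

lemma open_curve_preimage: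
  assumes "smooth_curve M I C" "openin (mtop M) U"
  shows "open {s \<in> I. C s \<in> U}"
proof -
  have "openin (top_of_set I) {s \<in> topspace (top_of_set I). C s \<in> U}"
    using assms by (intro openin_continuous_map_preimage) (auto simp: smooth_curve_def)
  then show ?thesis
    using assms(1) by (auto simp: smooth_curve_def intro: openin_open_trans)
qed

lemma smooth_curve_in_points: "smooth_curve M I C \<Longrightarrow> t \<in> I \<Longrightarrow> C t \<in> points M"
  by (auto simp: smooth_curve_def continuous_map_def)

locale manifold_chart =
  fixes M :: "('a, 'n::finite) manifold" and D :: "'a set" and \<psi> :: "'a \<Rightarrow> real ^ 'n"
  assumes manifold: "smooth_manifold M" and chart: "(D, \<psi>) \<in> atlas M"
begin

abbreviation \<psi>i :: "real ^ 'n \<Rightarrow> 'a" where "\<psi>i \<equiv> inv_into D \<psi>"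

abbreviation del :: "'n \<Rightarrow> 'a vfield" where "del \<equiv> coord_field M (D, \<psi>)"

abbreviation coord :: "'n \<Rightarrow> 'a \<Rightarrow> real" where "coord i \<equiv> \<lambda>q. \<psi> q $ i"

lemma openin_D: "openin (mtop M) D"
  and homeomorphic: "homeomorphic_map (subtopology (mtop M) D) (top_of_set (\<psi> ` D)) \<psi>"
  and open_chart_image: "open (\<psi> ` D)"
  using manifold chart unfolding smooth_manifold_def by blast+

lemma D_points: "D \<subseteq> points M"
  using openin_D openin_subset by blast

lemma inj_\<psi>: "inj_on \<psi> D"
  using homeomorphic_imp_injective_map[OF homeomorphic] D_points
  by (simp add: Int_absorb1)

lemma \<psi>i_\<psi> [simp]: "p \<in> D \<Longrightarrow> \<psi>i (\<psi> p) = p"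
  using inj_\<psi> by simp

lemma open_image:
  assumes "openin (mtop M) V" shows "open (\<psi> ` (D \<inter> V))"
proof -
  have "openin (subtopology (mtop M) D) (D \<inter> V)"
    using assms by (simp add: openin_subtopology_Int2)
  then have "openin (top_of_set (\<psi> ` D)) (\<psi> ` (D \<inter> V))"
    using homeomorphic_imp_open_map[OF homeomorphic] by (simp add: open_map_def)
  then show ?thesis
    using open_chart_image by (rule openin_open_trans)
qed

lemma transition:
  assumes "(D', \<psi>') \<in> atlas M" shows "smooth_on (\<psi> ` (D \<inter> D')) (\<lambda>x. \<psi>' (\<psi>i x))"
  using manifold chart assms unfolding smooth_manifold_def comp_def by blast

lemma other_chart: "(D', \<psi>') \<in> atlas M \<Longrightarrow> manifold_chart M D' \<psi>'"
  using manifold by (simp add: manifold_chart_def)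

text \<open>Changing charts composes with a smooth transition map, so inside one chart domain
  smoothness can be tested in that chart alone.\<close>

lemma smooth_fun_on_chart_iff:
  assumes V: "openin (mtop M) V" "V \<subseteq> D"
  shows "smooth_fun_on M V f \<longleftrightarrow> smooth_on (\<psi> ` V) (\<lambda>x. f (\<psi>i x))"
proof
  assume "smooth_fun_on M V f"
  then show "smooth_on (\<psi> ` V) (\<lambda>x. f (\<psi>i x))"
    using chart V(2) unfolding smooth_fun_on_def comp_def by (fastforce simp: Int_absorb1)
next
  assume f: "smooth_on (\<psi> ` V) (\<lambda>x. f (\<psi>i x))"
  show "smooth_fun_on M V f"
    unfolding smooth_fun_on_def
  proof clarify
    fix D' \<psi>' assume c: "(D', \<psi>') \<in> atlas M"
    interpret c': manifold_chart M D' \<psi>' using c by (rule other_chart)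
    have o: "open (\<psi>' ` (D' \<inter> V))" using V(1) by (rule c'.open_image)
    have "smooth_on (\<psi>' ` (D' \<inter> V)) (\<lambda>x. \<psi> (c'.\<psi>i x))"
      using c'.transition[OF chart] by (rule smooth_on_subset) (use V in auto)
    with o f have "smooth_on (\<psi>' ` (D' \<inter> V)) (\<lambda>x. f (\<psi>i (\<psi> (c'.\<psi>i x))))"
      by (rule smooth_on_compose) auto
    with o show "smooth_on (\<psi>' ` (D' \<inter> V)) (f \<circ> inv_into D' \<psi>')"
      by (rule smooth_on_transform) (use V(2) in auto)
  qed
qed

lemma smooth_nearE:
  assumes "smooth_near M p f" "p \<in> D"
  obtains V where "openin (mtop M) V" "p \<in> V" "V \<subseteq> D" "smooth_on (\<psi> ` V) (\<lambda>x. f (\<psi>i x))"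
proof -
  obtain U where U: "openin (mtop M) U" "p \<in> U" "smooth_fun_on M U f"
    using assms(1) unfolding smooth_near_def by blast
  have V: "openin (mtop M) (U \<inter> D)" using U(1) openin_D by blast
  have "smooth_fun_on M (U \<inter> D) f" using U(3) by (rule smooth_fun_on_subset) simp
  then show ?thesis
    using that[of "U \<inter> D"] U V assms(2) smooth_fun_on_chart_iff by auto
qed

lemma smooth_near_differentiable:
  assumes "smooth_near M p f" "p \<in> D" shows "(f \<circ> \<psi>i) differentiable at (\<psi> p)"
  using smooth_nearE[OF assms] smooth_on_differentiable
  unfolding comp_def by (metis imageI)

lemma smooth_fun_coord: "smooth_fun_on M D (coord i)"
proof -
  have "smooth_on (\<psi> ` D) (\<lambda>x. x $ i)"
    using open_chart_image bounded_linear_vec_nth by (rule smooth_on_linear)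
  with open_chart_image have "smooth_on (\<psi> ` D) (\<lambda>x. \<psi> (\<psi>i x) $ i)"
    by (rule smooth_on_transform) auto
  then show ?thesis
    by (simp add: smooth_fun_on_chart_iff openin_D)
qed

lemma smooth_near_coord: "p \<in> D \<Longrightarrow> smooth_near M p (coord i)"
  using smooth_fun_coord openin_D unfolding smooth_near_def by blast

text \<open>In the chart a coordinate function is a linear projection and hence its own derivative.
  Injectivity and independence of the coordinate fields are read off from this duality.\<close>

lemma del_coord: "p \<in> D \<Longrightarrow> del i p (coord j) = (if i = j then 1 else 0)"
proof -
  assume p: "p \<in> D"
  have "((\<lambda>x. x $ j) has_derivative (\<lambda>x. x $ j)) (at (\<psi> p))"
    by (rule bounded_linear_imp_has_derivative[OF bounded_linear_vec_nth])
  then have "((coord j \<circ> \<psi>i) has_derivative (\<lambda>x. x $ j)) (at (\<psi> p))"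
    by (rule has_derivative_transform_within_open[OF _ open_chart_image]) (use p in auto)
  then have "frechet_derivative (coord j \<circ> \<psi>i) (at (\<psi> p)) = (\<lambda>x. x $ j)"
    using frechet_derivative_at by metis
  then show ?thesis
    using p by (simp add: coord_field_def smooth_near_coord axis_def)
qed

lemma curve_coord_derivative:
  assumes C: "smooth_curve M I C" and t: "t \<in> I" "C t \<in> D"
  shows "((\<lambda>s. \<psi> (C s)) has_vector_derivative (\<chi> i. deriv (\<lambda>s. coord i (C s)) t)) (at t)"
    and "(\<lambda>s. coord i (C s)) field_differentiable at t"
proof -
  let ?N = "{s \<in> I. C s \<in> D}"
  have "smooth_on ?N (\<lambda>s. \<psi> (C s))"
    using C chart unfolding smooth_curve_def comp_def by blast
  then have "(\<lambda>s. \<psi> (C s)) differentiable at t"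
    by (rule smooth_on_differentiable) (use t in simp)
  then obtain d where d: "((\<lambda>s. \<psi> (C s)) has_vector_derivative d) (at t)"
    using vector_derivative_works by blast
  have "((\<lambda>s. coord i (C s)) has_real_derivative d $ i) (at t)" for i
    using bounded_linear.has_vector_derivative[OF bounded_linear_vec_nth d, of i]
    by (simp add: has_real_derivative_iff_has_vector_derivative)
  note di = this
  show "(\<lambda>s. coord i (C s)) field_differentiable at t"
    using di unfolding field_differentiable_def by blast
  have "(\<chi> i. deriv (\<lambda>s. coord i (C s)) t) = d"
    by (simp add: DERIV_imp_deriv[OF di] vec_eq_iff)
  with d show "((\<lambda>s. \<psi> (C s)) has_vector_derivative (\<chi> i. deriv (\<lambda>s. coord i (C s)) t)) (at t)"
    by simp
qed

text \<open>Chain rule through the chart: \<open>f\<close> along the curve is its coordinate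
  expression composed with the coordinates of \<open>C\<close>, and linearity of the Frechet
  derivative splits the velocity along the axes.\<close>

lemma fun_curve_derivative:
  assumes C: "smooth_curve M I C" and t: "t \<in> I" "C t \<in> D" and f: "smooth_near M (C t) f"
  shows "((\<lambda>s. f (C s)) has_real_derivative
    (\<Sum>i\<in>UNIV. deriv (\<lambda>s. coord i (C s)) t * del i (C t) f)) (at t)"
proof -
  let ?d = "\<chi> i. deriv (\<lambda>s. coord i (C s)) t"
  let ?F = "frechet_derivative (f \<circ> \<psi>i) (at (\<psi> (C t)))"
  have F: "((f \<circ> \<psi>i) has_derivative ?F) (at (\<psi> (C t)))"
    using smooth_near_differentiable[OF f t(2)] frechet_derivative_works by blast
  interpret F: linear ?F using F by (rule has_derivative_linear)
  have "((\<lambda>s. (f \<circ> \<psi>i) (\<psi> (C s))) has_derivative (\<lambda>x. ?F (x *\<^sub>R ?d))) (at t)"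
    using curve_coord_derivative(1)[OF C t] F unfolding has_vector_derivative_def
    by (rule has_derivative_compose)
  then have "((\<lambda>s. f (C s)) has_derivative (\<lambda>x. ?F (x *\<^sub>R ?d))) (at t)"
    by (rule has_derivative_transform_within_open[OF _ open_curve_preimage[OF C openin_D]])
      (use t in auto)
  then have "((\<lambda>s. f (C s)) has_real_derivative ?F ?d) (at t)"
    by (simp add: has_real_derivative_iff_has_vector_derivative has_vector_derivative_def F.scale)
  moreover have "?F ?d = (\<Sum>i\<in>UNIV. deriv (\<lambda>s. coord i (C s)) t * del i (C t) f)"
  proof -
    have "?F ?d = ?F (\<Sum>i\<in>UNIV. ?d $ i *\<^sub>R axis i 1)"
      by (rule arg_cong[where f = ?F]) (rule basis_expansion[of ?d, unfolded scalar_mult_eq_scaleR, symmetric])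
    also have "\<dots> = (\<Sum>i\<in>UNIV. ?d $ i *\<^sub>R ?F (axis i 1))"
      by (simp only: F.sum F.scale)
    finally show ?thesis
      using f by (simp add: coord_field_def)
  qed
  ultimately show ?thesis by simp
qed

lemma velocity_eq:
  assumes "smooth_curve M I C" "t \<in> I" "C t \<in> D"
  shows "velocity M C t = (\<Sum>i\<in>UNIV. deriv (\<lambda>s. coord i (C s)) t *\<^sub>R del i (C t))"
proof
  fix f
  show "velocity M C t f = (\<Sum>i\<in>UNIV. deriv (\<lambda>s. coord i (C s)) t *\<^sub>R del i (C t)) f"
  proof (cases "smooth_near M (C t) f")
    case True
    then show ?thesis
      using DERIV_imp_deriv[OF fun_curve_derivative[OF assms True]]
      by (simp add: velocity_def sum_fun_apply)
  next
    \<comment> \<open>Both sides take the default value 0 on functions that are not smooth near the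
      point.\<close>
    case False
    then show ?thesis by (simp add: velocity_def sum_fun_apply coord_field_def)
  qed
qed

text \<open>Tangent vectors are velocities by definition, so a curve must be produced: the straight
  line through \<open>\<psi> p\<close> in direction \<open>c\<close>, pulled back by the chart and
  restricted to times at which it stays in the chart image.\<close>

lemma coord_vector_in_tangent_space:
  assumes p: "p \<in> D"
  shows "(\<Sum>i\<in>UNIV. c $ i *\<^sub>R del i p) \<in> tangent_space M p"
proof -
  let ?L = "\<lambda>t::real. \<psi> p + t *\<^sub>R c"
  have cont: "continuous_on UNIV ?L" by (intro continuous_intros)
  have "open (?L -` (\<psi> ` D))"
    using open_chart_image cont by (simp add: open_vimage)
  moreover have "0 \<in> ?L -` (\<psi> ` D)" using p by simp
  ultimately obtain e where e: "e > 0" "ball 0 e \<subseteq> ?L -` (\<psi> ` D)"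
    by (meson open_contains_ball)
  define I where "I = ball (0::real) e"
  define \<gamma> where "\<gamma> t = \<psi>i (?L t)" for t
  have L: "?L t \<in> \<psi> ` D" if "t \<in> I" for t using e that by (auto simp: I_def)
  have I: "open I" "is_interval I" "0 \<in> I" using e by (auto simp: I_def is_interval_ball_real)
  have \<gamma>D: "\<gamma> t \<in> D" and \<psi>\<gamma>: "\<psi> (\<gamma> t) = ?L t" if "t \<in> I" for t
    using L[OF that] by (auto simp: \<gamma>_def inv_into_into f_inv_into_f)
  \<comment> \<open>Serves both the continuity of \<open>\<gamma>\<close> and the openness of the
    sets on which its smoothness is tested in other charts.\<close>
  have pre: "open {t \<in> I. \<gamma> t \<in> U}" if U: "openin (mtop M) U" for U
  proof -
    have "\<gamma> t \<in> U \<longleftrightarrow> ?L t \<in> \<psi> ` (D \<inter> U)" if "t \<in> I" for t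
    proof
      assume "\<gamma> t \<in> U"
      then show "?L t \<in> \<psi> ` (D \<inter> U)"
        using \<gamma>D[OF that] \<psi>\<gamma>[OF that] by (intro image_eqI[of _ _ "\<gamma> t"]) auto
    qed (auto simp: \<gamma>_def)
    then have "{t \<in> I. \<gamma> t \<in> U} = I \<inter> ?L -` (\<psi> ` (D \<inter> U))" by blast
    then show ?thesis
      using open_image[OF U] cont I(1) by (simp add: open_vimage open_Int)
  qed
  have smooth: "smooth_curve M I \<gamma>"
    unfolding smooth_curve_def
  proof (intro conjI ballI)
    show "continuous_map (top_of_set I) (mtop M) \<gamma>"
      unfolding continuous_map_def
      using \<gamma>D D_points pre I(1) by (auto simp: openin_open_eq)
  next
    fix x assume "x \<in> atlas M"
    then obtain D' \<psi>' where x: "x = (D', \<psi>')" and c: "(D', \<psi>') \<in> atlas M" by (cases x) auto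
    interpret c': manifold_chart M D' \<psi>' using c by (rule other_chart)
    let ?N = "{t \<in> I. \<gamma> t \<in> D'}"
    have o: "open ?N" using c'.openin_D by (rule pre)
    have "smooth_on ?N ?L"
      by (intro smooth_on_add o smooth_on_const smooth_on_linear bounded_linear_scaleR_left)
    moreover have "?L ` ?N \<subseteq> \<psi> ` (D \<inter> D')"
    proof clarify
      fix t assume "t \<in> I" "\<gamma> t \<in> D'"
      then show "?L t \<in> \<psi> ` (D \<inter> D')"
        using \<gamma>D \<psi>\<gamma> by (intro image_eqI[of _ _ "\<gamma> t"]) auto
    qed
    ultimately have "smooth_on ?N (\<lambda>t. \<psi>' (\<psi>i (?L t)))"
      using smooth_on_compose[OF o transition[OF c]] by blast
    then show "case x of (D, \<psi>) \<Rightarrow> smooth_on {t \<in> I. \<gamma> t \<in> D} (\<psi> \<circ> \<gamma>)"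
      by (simp add: x \<gamma>_def comp_def)
  qed (use I in auto)
  have \<gamma>0: "\<gamma> 0 = p" using p by (simp add: \<gamma>_def)
  have "deriv (\<lambda>s. coord i (\<gamma> s)) 0 = c $ i" for i
  proof -
    have "((\<lambda>s. \<psi> p $ i + s * c $ i) has_real_derivative c $ i) (at 0)"
      by (auto intro!: derivative_eq_intros)
    then have "((\<lambda>s. coord i (\<gamma> s)) has_real_derivative c $ i) (at 0)"
      by (rule has_field_derivative_transform_within_open[OF _ I(1,3)]) (simp add: \<psi>\<gamma>)
    then show ?thesis by (rule DERIV_imp_deriv)
  qed
  then have "velocity M \<gamma> 0 = (\<Sum>i\<in>UNIV. c $ i *\<^sub>R del i p)"
    using velocity_eq[OF smooth I(3)] \<gamma>0 p by simp
  then show ?thesis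
    unfolding tangent_space_def using smooth I(3) \<gamma>0 by (intro CollectI exI[of _ \<gamma>]) auto
qed

lemma tangent_spaceE:
  assumes "p \<in> D" "v \<in> tangent_space M p"
  obtains c where "v = (\<Sum>i\<in>UNIV. c $ i *\<^sub>R del i p)"
proof -
  obtain \<gamma> I where g: "smooth_curve M I \<gamma>" "0 \<in> I" "\<gamma> 0 = p" "v = velocity M \<gamma> 0"
    using assms(2) unfolding tangent_space_def by blast
  then have "v = (\<Sum>i\<in>UNIV. (\<chi> i. deriv (\<lambda>s. coord i (\<gamma> s)) 0) $ i *\<^sub>R del i p)"
    using velocity_eq[OF g(1,2)] assms(1) by simp
  then show ?thesis using that by blast
qed

text \<open>The definition by curves does not make the tangent space visibly closed under addition.
  Closure comes from identifying it with the combinations of coordinate fields, where addition acts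
  on coefficient vectors.\<close>

lemma tangent_space_eq_span:
  assumes p: "p \<in> D" shows "tangent_space M p = span (range (\<lambda>i. del i p))"
proof
  show "tangent_space M p \<subseteq> span (range (\<lambda>i. del i p))"
  proof
    fix v assume "v \<in> tangent_space M p"
    then obtain c where "v = (\<Sum>i\<in>UNIV. c $ i *\<^sub>R del i p)" using tangent_spaceE[OF p] by blast
    then show "v \<in> span (range (\<lambda>i. del i p))" by (simp add: span_sum span_scale span_base)
  qed
  have eq: "tangent_space M p = range (\<lambda>c. \<Sum>i\<in>UNIV. c $ i *\<^sub>R del i p)"
    using tangent_spaceE[OF p] coord_vector_in_tangent_space[OF p] by blast
  have "subspace (tangent_space M p)"
    unfolding eq
  proof (rule subspaceI)
    show "0 \<in> range (\<lambda>c. \<Sum>i\<in>UNIV. c $ i *\<^sub>R del i p)"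
      by (rule range_eqI[of _ _ 0]) simp
  next
    fix x y assume "x \<in> range (\<lambda>c. \<Sum>i\<in>UNIV. c $ i *\<^sub>R del i p)"
      "y \<in> range (\<lambda>c. \<Sum>i\<in>UNIV. c $ i *\<^sub>R del i p)"
    then obtain c d where "x = (\<Sum>i\<in>UNIV. c $ i *\<^sub>R del i p)" "y = (\<Sum>i\<in>UNIV. d $ i *\<^sub>R del i p)"
      by blast
    then show "x + y \<in> range (\<lambda>c. \<Sum>i\<in>UNIV. c $ i *\<^sub>R del i p)"
      by (intro range_eqI[of _ _ "c + d"]) (simp add: scaleR_add_left sum.distrib)
  next
    fix r x assume "x \<in> range (\<lambda>c. \<Sum>i\<in>UNIV. c $ i *\<^sub>R del i p)"
    then obtain c where "x = (\<Sum>i\<in>UNIV. c $ i *\<^sub>R del i p)" by blast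
    then show "r *\<^sub>R x \<in> range (\<lambda>c. \<Sum>i\<in>UNIV. c $ i *\<^sub>R del i p)"
      by (intro range_eqI[of _ _ "r *\<^sub>R c"]) (simp add: scaleR_sum_right)
  qed
  moreover have "del i p \<in> tangent_space M p" for i
  proof -
    have "(\<Sum>j\<in>UNIV. axis i 1 $ j *\<^sub>R del j p) = del i p"
      by (simp add: axis_def if_distrib[of "\<lambda>r. r *\<^sub>R _"] cong: if_cong)
    then show ?thesis using coord_vector_in_tangent_space[OF p] by metis
  qed
  ultimately show "span (range (\<lambda>i. del i p)) \<subseteq> tangent_space M p"
    by (intro span_minimal) auto
qed

lemma inj_del: "p \<in> D \<Longrightarrow> inj (\<lambda>i. del i p)"
  by (rule injI) (metis del_coord zero_neq_one)

lemma independent_del: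
  assumes p: "p \<in> D" shows "independent (range (\<lambda>i. del i p))"
proof
  assume "dependent (range (\<lambda>i. del i p))"
  then obtain u w where w: "w \<in> range (\<lambda>i. del i p)" "u w \<noteq> 0"
    and u: "(\<Sum>v\<in>range (\<lambda>i. del i p). u v *\<^sub>R v) = 0"
    by (auto simp: dependent_finite)
  obtain k where k: "w = del k p" using w(1) by blast
  \<comment> \<open>Evaluating the linear relation on \<open>coord k\<close> isolates the
    coefficient of \<open>del k\<close>.\<close>
  have "0 = (\<Sum>i\<in>UNIV. u (del i p) *\<^sub>R del i p) (coord k)"
    using u by (simp add: sum.reindex[OF inj_del[OF p]])
  also have "\<dots> = (\<Sum>i\<in>UNIV. if i = k then u (del i p) else 0)"
    by (simp add: sum_fun_apply del_coord[OF p] if_distrib cong: if_cong)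
  also have "\<dots> = u w" using k by simp
  finally show False using w(2) by simp
qed

text \<open>In the chart, \<open>del i\<close> takes a partial derivative, and partial derivatives
  of smooth maps are smooth.\<close>

lemma smooth_vfield_del: "smooth_vfield_on M D (del i)"
  unfolding smooth_vfield_on_def
proof (intro conjI ballI allI impI)
  show "del i p \<in> tangent_space M p" if "p \<in> D" for p
    using that by (simp add: tangent_space_eq_span span_base)
next
  fix V f assume "openin (mtop M) V \<and> V \<subseteq> D \<and> smooth_fun_on M V f"
  then have V: "openin (mtop M) V" "V \<subseteq> D" and f: "smooth_fun_on M V f" by auto
  have near: "smooth_near M p f" if "p \<in> V" for p
    using V f that unfolding smooth_near_def by blast
  have "open (\<psi> ` V)" using open_image[OF V(1)] V(2) by (simp add: Int_absorb1)
  moreover have "smooth_on (\<psi> ` V) (\<lambda>x. frechet_derivative (\<lambda>x. f (\<psi>i x)) (at x) (axis i 1))"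
    using f V by (simp add: smooth_fun_on_chart_iff smooth_on_frechet_derivative)
  ultimately have "smooth_on (\<psi> ` V) (\<lambda>x. del i (\<psi>i x) f)"
    by (rule smooth_on_transform) (use V near in \<open>auto simp: coord_field_def comp_def subset_iff\<close>)
  then show "smooth_fun_on M V (\<lambda>p. del i p f)"
    using V by (simp add: smooth_fun_on_chart_iff)
qed

lemma local_frame_del: "local_frame M D del"
  unfolding local_frame_def
  using smooth_vfield_del inj_del independent_del tangent_space_eq_span by blast

end

section \<open>Tangent spaces and velocities without reference to a chart\<close>

lemma manifold_chart_at:
  assumes "smooth_manifold M" "p \<in> points M"
  obtains D \<psi> where "manifold_chart M D \<psi>" "p \<in> D"
proof -
  have "p \<in> (\<Union>(D, \<psi>)\<in>atlas M. D)" using assms by (simp add: smooth_manifold_def)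
  then show ?thesis using that assms(1) by (auto simp: manifold_chart_def)
qed

lemma subspace_tangent_space:
  assumes "smooth_manifold M" "p \<in> points M" shows "subspace (tangent_space M p)"
proof -
  obtain D \<psi> where "manifold_chart M D \<psi>" "p \<in> D" using manifold_chart_at[OF assms] .
  then show ?thesis by (simp add: manifold_chart.tangent_space_eq_span)
qed

lemma velocity_in_tangent_space:
  assumes M: "smooth_manifold M" and C: "smooth_curve M I C" "t \<in> I"
  shows "velocity M C t \<in> tangent_space M (C t)"
proof -
  obtain D \<psi> where "manifold_chart M D \<psi>" and D: "C t \<in> D"
    using manifold_chart_at[OF M smooth_curve_in_points[OF C]] .
  then interpret manifold_chart M D \<psi> by simp
  show ?thesis
    using velocity_eq[OF C D] by (simp add: tangent_space_eq_span[OF D] span_sum span_scale span_base)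
qed

lemma has_real_derivative_velocity:
  assumes M: "smooth_manifold M" and C: "smooth_curve M I C" "t \<in> I" and f: "smooth_near M (C t) f"
  shows "((\<lambda>s. f (C s)) has_real_derivative velocity M C t f) (at t)"
proof -
  obtain D \<psi> where "manifold_chart M D \<psi>" and D: "C t \<in> D"
    using manifold_chart_at[OF M smooth_curve_in_points[OF C]] .
  then interpret manifold_chart M D \<psi> by simp
  show ?thesis
    using fun_curve_derivative[OF C D f] f by (simp add: velocity_def DERIV_imp_deriv)
qed

section \<open>Pointwise operations on smooth functions and vector fields\<close>

lemma smooth_fun_on_transform:
  assumes M: "smooth_manifold M" and U: "openin (mtop M) U"
    and f: "smooth_fun_on M U f" "\<And>q. q \<in> U \<Longrightarrow> f q = h q"
  shows "smooth_fun_on M U h"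
  unfolding smooth_fun_on_def
proof clarify
  fix D \<psi> assume c: "(D, \<psi>) \<in> atlas M"
  interpret manifold_chart M D \<psi> using M c by (simp add: manifold_chart_def)
  have "smooth_on (\<psi> ` (D \<inter> U)) (f \<circ> \<psi>i)" using f(1) c unfolding smooth_fun_on_def by blast
  with open_image[OF U] show "smooth_on (\<psi> ` (D \<inter> U)) (h \<circ> \<psi>i)"
    by (rule smooth_on_transform) (auto simp: f(2))
qed

lemma smooth_fun_on_add:
  assumes M: "smooth_manifold M" and U: "openin (mtop M) U"
    and f: "smooth_fun_on M U f" "smooth_fun_on M U h"
  shows "smooth_fun_on M U (\<lambda>q. f q + h q)"
  unfolding smooth_fun_on_def
proof clarify
  fix D \<psi> assume c: "(D, \<psi>) \<in> atlas M"
  interpret manifold_chart M D \<psi> using M c by (simp add: manifold_chart_def)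
  have "smooth_on (\<psi> ` (D \<inter> U)) (f \<circ> \<psi>i)" "smooth_on (\<psi> ` (D \<inter> U)) (h \<circ> \<psi>i)"
    using f c unfolding smooth_fun_on_def by blast+
  with open_image[OF U] show "smooth_on (\<psi> ` (D \<inter> U)) ((\<lambda>q. f q + h q) \<circ> \<psi>i)"
    unfolding comp_def by (rule smooth_on_add)
qed

lemma smooth_fun_on_scale:
  assumes M: "smooth_manifold M" and U: "openin (mtop M) U" and f: "smooth_fun_on M U f"
  shows "smooth_fun_on M U (\<lambda>q. r * f q)"
  unfolding smooth_fun_on_def
proof clarify
  fix D \<psi> assume c: "(D, \<psi>) \<in> atlas M"
  interpret manifold_chart M D \<psi> using M c by (simp add: manifold_chart_def)
  have "smooth_on (\<psi> ` (D \<inter> U)) (f \<circ> \<psi>i)" using f c unfolding smooth_fun_on_def by blast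
  with open_image[OF U] bounded_linear_mult_right
  show "smooth_on (\<psi> ` (D \<inter> U)) ((\<lambda>q. r * f q) \<circ> \<psi>i)"
    unfolding comp_def by (rule smooth_on_bounded_linear)
qed

lemma smooth_fun_on_const:
  assumes M: "smooth_manifold M" and U: "openin (mtop M) U"
  shows "smooth_fun_on M U (\<lambda>q. r)"
  unfolding smooth_fun_on_def
proof clarify
  fix D \<psi> assume c: "(D, \<psi>) \<in> atlas M"
  interpret manifold_chart M D \<psi> using M c by (simp add: manifold_chart_def)
  show "smooth_on (\<psi> ` (D \<inter> U)) ((\<lambda>q. r) \<circ> \<psi>i)"
    unfolding comp_def using open_image[OF U] by (rule smooth_on_const)
qed

lemma smooth_vfield_on_add:
  assumes M: "smooth_manifold M" and U: "U \<subseteq> points M"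
    and X: "smooth_vfield_on M U X" "smooth_vfield_on M U Y"
  shows "smooth_vfield_on M U (\<lambda>q. X q + Y q)"
  using X U subspace_add[OF subspace_tangent_space[OF M]] smooth_fun_on_add[OF M]
  unfolding smooth_vfield_on_def by (simp add: subset_iff)

lemma smooth_vfield_on_scale:
  assumes M: "smooth_manifold M" and U: "U \<subseteq> points M" and X: "smooth_vfield_on M U X"
  shows "smooth_vfield_on M U (\<lambda>q. r *\<^sub>R X q)"
  using X U subspace_scale[OF subspace_tangent_space[OF M]] smooth_fun_on_scale[OF M]
  unfolding smooth_vfield_on_def by (simp add: subset_iff)

lemma smooth_vfield_on_zero:
  assumes M: "smooth_manifold M" and U: "U \<subseteq> points M"
  shows "smooth_vfield_on M U (\<lambda>q. 0)"
  using U subspace_0[OF subspace_tangent_space[OF M]] smooth_fun_on_const[OF M]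
  unfolding smooth_vfield_on_def by (simp add: subset_iff)

lemma smooth_vfield_on_sum:
  assumes M: "smooth_manifold M" and U: "U \<subseteq> points M"
    and X: "\<And>i. i \<in> A \<Longrightarrow> smooth_vfield_on M U (X i)"
  shows "smooth_vfield_on M U (\<lambda>q. \<Sum>i\<in>A. X i q)"
  using X
  by (induction A rule: infinite_finite_induct)
    (simp_all add: smooth_vfield_on_zero[OF M U] smooth_vfield_on_add[OF M U])

section \<open>Tangent vectors as local operators\<close>

lemma tangent_vector_not_smooth:
  "v \<in> tangent_space M p \<Longrightarrow> \<not> smooth_near M p f \<Longrightarrow> v f = 0"
  by (auto simp: tangent_space_def velocity_def)

lemma smooth_near_transform:
  assumes M: "smooth_manifold M" and U: "openin (mtop M) U" "p \<in> U"
    and eq: "\<And>q. q \<in> U \<Longrightarrow> f q = h q" and f: "smooth_near M p f"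
  shows "smooth_near M p h"
proof -
  obtain V where V: "openin (mtop M) V" "p \<in> V" "smooth_fun_on M V f"
    using f unfolding smooth_near_def by blast
  have o: "openin (mtop M) (V \<inter> U)" using V U by blast
  have "smooth_fun_on M (V \<inter> U) f" using V(3) by (rule smooth_fun_on_subset) simp
  with M o have "smooth_fun_on M (V \<inter> U) h"
    by (rule smooth_fun_on_transform) (simp add: eq)
  then show ?thesis unfolding smooth_near_def using o V U by blast
qed

text \<open>A derivative along a curve sees only values near the base point. Smoothness near
  \<open>p\<close> is equally local, so the default value 0 is taken on both functions or on
  neither.\<close>

lemma tangent_vector_transform:
  assumes M: "smooth_manifold M" and v: "v \<in> tangent_space M p"
    and U: "openin (mtop M) U" "p \<in> U" and eq: "\<And>q. q \<in> U \<Longrightarrow> f q = h q"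
  shows "v f = v h"
proof (cases "smooth_near M p f")
  case True
  have near: "smooth_near M p h" using M U eq True by (rule smooth_near_transform)
  obtain \<gamma> I where g: "smooth_curve M I \<gamma>" "0 \<in> I" "\<gamma> 0 = p" "v = velocity M \<gamma> 0"
    using v unfolding tangent_space_def by blast
  have "((\<lambda>s. f (\<gamma> s)) has_real_derivative v f) (at 0)"
    using has_real_derivative_velocity[OF M g(1,2)] True g by simp
  then have "((\<lambda>s. h (\<gamma> s)) has_real_derivative v f) (at 0)"
    by (rule has_field_derivative_transform_within_open[OF _ open_curve_preimage[OF g(1) U(1)]])
      (use g U eq in auto)
  moreover have "((\<lambda>s. h (\<gamma> s)) has_real_derivative v h) (at 0)"
    using has_real_derivative_velocity[OF M g(1,2)] near g by simp
  ultimately show ?thesis by (rule DERIV_unique)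
next
  case False
  then have "\<not> smooth_near M p h"
    using smooth_near_transform[OF M U, of h f] eq by auto
  then show ?thesis using v False by (simp add: tangent_vector_not_smooth)
qed

lemma tangent_vector_add:
  assumes M: "smooth_manifold M" and v: "v \<in> tangent_space M p"
    and U: "openin (mtop M) U" "p \<in> U" and f: "smooth_fun_on M U f" "smooth_fun_on M U h"
  shows "v (\<lambda>q. f q + h q) = v f + v h"
proof -
  obtain \<gamma> I where g: "smooth_curve M I \<gamma>" "0 \<in> I" "\<gamma> 0 = p" "v = velocity M \<gamma> 0"
    using v unfolding tangent_space_def by blast
  have near: "smooth_near M p f" "smooth_near M p h" "smooth_near M p (\<lambda>q. f q + h q)"
    using U f smooth_fun_on_add[OF M U(1) f] unfolding smooth_near_def by blast+
  have D: "((\<lambda>s. k (\<gamma> s)) has_real_derivative v k) (at 0)" if "smooth_near M p k" for k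
    using has_real_derivative_velocity[OF M g(1,2)] that g by simp
  show ?thesis
    using DERIV_unique[OF D[OF near(3)] DERIV_add[OF D[OF near(1)] D[OF near(2)]]] .
qed

section \<open>Almost contact B-metric vector spaces\<close>

lemma linear_on_subspaceD:
  assumes "linear_on_subspace T L"
  shows linear_on_subspace_add: "v \<in> T \<Longrightarrow> w \<in> T \<Longrightarrow> L (v + w) = L v + L w"
    and linear_on_subspace_scale: "v \<in> T \<Longrightarrow> L (c *\<^sub>R v) = c *\<^sub>R L v"
  using assms by (auto simp: linear_on_subspace_def)

lemma linear_on_subspace_zero:
  assumes "linear_on_subspace T L" "subspace T" shows "L 0 = 0"
  using linear_on_subspace_scale[OF assms(1) subspace_0[OF assms(2)], of 0] by simp

lemma linear_on_subspace_minus: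
  assumes "linear_on_subspace T L" "v \<in> T" shows "L (- v) = - L v"
  using linear_on_subspace_scale[OF assms, of "-1"] by simp

lemma linear_on_subspace_diff:
  assumes L: "linear_on_subspace T L" and T: "subspace T" "v \<in> T" "w \<in> T"
  shows "L (v - w) = L v - L w"
  using linear_on_subspace_add[OF L T(2) subspace_neg[OF T(1,3)]] linear_on_subspace_minus[OF L T(3)]
  by simp

lemma linear_on_subspace_sum:
  assumes L: "linear_on_subspace T L" and T: "subspace T" "\<And>i. i \<in> A \<Longrightarrow> v i \<in> T"
  shows "L (\<Sum>i\<in>A. c i *\<^sub>R v i) = (\<Sum>i\<in>A. c i *\<^sub>R L (v i))"
  using T(2)
proof (induction A rule: infinite_finite_induct)
  case (insert x A)
  have "L (c x *\<^sub>R v x + (\<Sum>i\<in>A. c i *\<^sub>R v i)) = L (c x *\<^sub>R v x) + L (\<Sum>i\<in>A. c i *\<^sub>R v i)"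
    using insert T(1)
    by (intro linear_on_subspace_add[OF L] subspace_scale subspace_sum) auto
  then show ?case using insert by (simp add: linear_on_subspace_scale[OF L])
qed (simp_all add: linear_on_subspace_zero[OF L T(1)])

text \<open>The linear algebra of a single tangent space, detached from the manifold. Tangent spaces
  sit inside an infinite-dimensional function space, so linearity is demanded on \<open>T\<close>
  only, and the dimension enters later through a spanning set of at most three vectors.\<close>

locale contact_B_space =
  fixes T :: "'v::real_vector set" and g :: "'v \<Rightarrow> 'v \<Rightarrow> real" and \<phi> :: "'v \<Rightarrow> 'v"
    and \<xi> :: 'v and \<eta> :: "'v \<Rightarrow> real"
  assumes subspace: "subspace T"
    and linear_\<phi>: "linear_on_subspace T \<phi>" and \<phi>_in [simp]: "v \<in> T \<Longrightarrow> \<phi> v \<in> T"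
    and linear_\<eta>: "linear_on_subspace T \<eta>" and \<xi>_in [simp]: "\<xi> \<in> T"
    and linear_g_right: "v \<in> T \<Longrightarrow> linear_on_subspace T (g v)"
    and linear_g_left: "v \<in> T \<Longrightarrow> linear_on_subspace T (\<lambda>w. g w v)"
    and g_sym: "v \<in> T \<Longrightarrow> w \<in> T \<Longrightarrow> g v w = g w v"
    and g_nondegenerate: "v \<in> T \<Longrightarrow> (\<And>w. w \<in> T \<Longrightarrow> g v w = 0) \<Longrightarrow> v = 0"
    and \<eta>_\<xi> [simp]: "\<eta> \<xi> = 1"
    and \<phi>_\<phi>: "v \<in> T \<Longrightarrow> \<phi> (\<phi> v) = - v + \<eta> v *\<^sub>R \<xi>"
    and g_\<phi>_\<phi>: "v \<in> T \<Longrightarrow> w \<in> T \<Longrightarrow> g (\<phi> v) (\<phi> w) = - g v w + \<eta> v * \<eta> w"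
begin

definition gt :: "'v \<Rightarrow> 'v \<Rightarrow> real" where "gt v w = g v (\<phi> w) + \<eta> v * \<eta> w"

lemma in_T [simp]:
  "v \<in> T \<Longrightarrow> w \<in> T \<Longrightarrow> v + w \<in> T" "v \<in> T \<Longrightarrow> w \<in> T \<Longrightarrow> v - w \<in> T"
  "v \<in> T \<Longrightarrow> r *\<^sub>R v \<in> T" "v \<in> T \<Longrightarrow> - v \<in> T" "0 \<in> T"
  using subspace by (auto simp: subspace_add subspace_diff subspace_scale subspace_neg subspace_0)

lemmas linear_simps =
  linear_on_subspace_add[OF linear_\<phi>] linear_on_subspace_diff[OF linear_\<phi> subspace]
  linear_on_subspace_scale[OF linear_\<phi>] linear_on_subspace_minus[OF linear_\<phi>]
  linear_on_subspace_add[OF linear_\<eta>] linear_on_subspace_diff[OF linear_\<eta> subspace]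
  linear_on_subspace_scale[OF linear_\<eta>] linear_on_subspace_minus[OF linear_\<eta>]
  linear_on_subspace_add[OF linear_g_right] linear_on_subspace_diff[OF linear_g_right subspace]
  linear_on_subspace_scale[OF linear_g_right] linear_on_subspace_minus[OF linear_g_right]
  linear_on_subspace_add[OF linear_g_left] linear_on_subspace_diff[OF linear_g_left subspace]
  linear_on_subspace_scale[OF linear_g_left] linear_on_subspace_minus[OF linear_g_left]

lemma \<xi>_nonzero: "\<xi> \<noteq> 0"
  using linear_on_subspace_zero[OF linear_\<eta> subspace] \<eta>_\<xi> by (metis zero_neq_one)

text \<open>Since \<phi> applied twice kills \<xi>, a third application makes
  \<open>\<phi> \<xi>\<close> the multiple \<eta>(\<phi> \<xi>) of \<xi>. Applying \<phi> to this
  relation shows that the factor or the vector \<open>\<phi> \<xi>\<close> is zero, and either gives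
  the claim.\<close>

lemma \<phi>_\<xi> [simp]: "\<phi> \<xi> = 0"
proof -
  have 0: "\<phi> (\<phi> \<xi>) = 0" by (simp add: \<phi>_\<phi>)
  have "\<phi> (\<phi> (\<phi> \<xi>)) = - \<phi> \<xi> + \<eta> (\<phi> \<xi>) *\<^sub>R \<xi>" by (rule \<phi>_\<phi>) simp
  then have eq: "\<eta> (\<phi> \<xi>) *\<^sub>R \<xi> = \<phi> \<xi>"
    by (simp add: 0 linear_on_subspace_zero[OF linear_\<phi> subspace])
  then have "\<eta> (\<phi> \<xi>) *\<^sub>R \<phi> \<xi> = \<phi> (\<phi> \<xi>)"
    using linear_on_subspace_scale[OF linear_\<phi> \<xi>_in, of "\<eta> (\<phi> \<xi>)"] by simp
  with 0 eq show ?thesis by auto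
qed

text \<open>The third power of \<phi> at \<open>v\<close> is evaluated twice, with the inner and
  with the outer square replaced; the results differ by \<eta>(\<phi> v) times the nonzero vector
  \<xi>.\<close>

lemma \<eta>_\<phi> [simp]:
  assumes "v \<in> T" shows "\<eta> (\<phi> v) = 0"
proof -
  have "\<phi> (\<phi> (\<phi> v)) = - \<phi> v"
    using assms by (simp add: \<phi>_\<phi>[OF assms] linear_simps)
  moreover have "\<phi> (\<phi> (\<phi> v)) = - \<phi> v + \<eta> (\<phi> v) *\<^sub>R \<xi>"
    using assms by (intro \<phi>_\<phi>) simp
  ultimately show ?thesis using \<xi>_nonzero by simp
qed

lemma g_zero [simp]: "v \<in> T \<Longrightarrow> g v 0 = 0" "v \<in> T \<Longrightarrow> g 0 v = 0"
  using linear_on_subspace_zero[OF linear_g_right subspace]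
    linear_on_subspace_zero[OF linear_g_left subspace] by auto

lemma g_\<xi> [simp]: "v \<in> T \<Longrightarrow> g v \<xi> = \<eta> v"
  using g_\<phi>_\<phi>[of v \<xi>] by simp

text \<open>Compatibility of \<open>g\<close> and \<phi> at the pair \<open>v\<close>,
  \<open>\<phi> w\<close>; the correction terms contain \<eta>(\<phi> v) or \<eta>(\<phi> w) and
  vanish. The symmetry of the associated metric rests on this.\<close>

lemma g_\<phi>_sym:
  assumes "v \<in> T" "w \<in> T" shows "g (\<phi> v) w = g v (\<phi> w)"
  using g_\<phi>_\<phi>[of v "\<phi> w"] assms by (simp add: \<phi>_\<phi> linear_simps)

lemma gt_eq:
  assumes "v \<in> T" "w \<in> T" shows "gt v w = g v (\<phi> w) + g v w + g (\<phi> v) (\<phi> w)"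
  using assms by (simp add: gt_def g_\<phi>_\<phi>)

lemma gt_sym: "v \<in> T \<Longrightarrow> w \<in> T \<Longrightarrow> gt v w = gt w v"
  using g_sym[of "\<phi> v" w] by (simp add: gt_def g_\<phi>_sym)

lemma gt_linear:
  assumes "u \<in> T" "v \<in> T" "w \<in> T"
  shows "gt (u + v) w = gt u w + gt v w" "gt (u - v) w = gt u w - gt v w"
    "gt w (u + v) = gt w u + gt w v" "gt w (u - v) = gt w u - gt w v"
  using assms by (simp_all add: gt_def linear_simps algebra_simps)

text \<open>Testing against \<xi> gives \<eta>(v) = 0; testing against \<open>\<phi> w\<close> then
  recovers -g(v, w), so nondegeneracy is inherited from \<open>g\<close>.\<close>

lemma gt_nondegenerate:
  assumes v: "v \<in> T" and 0: "\<And>w. w \<in> T \<Longrightarrow> gt v w = 0"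
  shows "v = 0"
proof (rule g_nondegenerate[OF v])
  fix w assume w: "w \<in> T"
  have "\<eta> v = 0" using 0[of \<xi>] v by (simp add: gt_def)
  then show "g v w = 0"
    using 0[of "\<phi> w"] v w by (simp add: gt_def \<phi>_\<phi> linear_simps)
qed

text \<open>On the kernel of \<eta> the map \<phi> squares to -1 and so has no real eigenvector
  there. Hence \<open>v\<close>, \<open>\<phi> v\<close> and \<xi> are independent, and a fourth
  independent vector would exceed the bound on \<open>card B\<close>.\<close>

lemma decomposition:
  assumes v: "v \<in> T" "v \<noteq> 0" "\<eta> v = 0" and B: "T \<subseteq> span B" "finite B" "card B \<le> 3" and w: "w \<in> T"
  obtains x y z where "w = x *\<^sub>R v + y *\<^sub>R \<phi> v + z *\<^sub>R \<xi>"
proof -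
  have \<phi>v: "\<phi> (\<phi> v) = - v" using v by (simp add: \<phi>_\<phi>)
  have 1: "\<phi> v \<notin> span {\<xi>}"
  proof
    assume "\<phi> v \<in> span {\<xi>}"
    then obtain k where k: "\<phi> v = k *\<^sub>R \<xi>" by (auto simp: span_singleton)
    have "\<phi> (\<phi> v) = 0" unfolding k by (simp add: linear_simps)
    then show False using \<phi>v v(2) by simp
  qed
  have 2: "v \<notin> span {\<phi> v, \<xi>}"
  proof
    assume "v \<in> span {\<phi> v, \<xi>}"
    then obtain k l where kl: "v - k *\<^sub>R \<phi> v = l *\<^sub>R \<xi>"
      by (auto simp: span_breakdown_eq[of _ "\<phi> v"] span_singleton)
    have "\<eta> (v - k *\<^sub>R \<phi> v) = 0" using v by (simp add: linear_simps)
    then have "l = 0" by (simp add: kl linear_simps)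
    with kl have eq: "v = k *\<^sub>R \<phi> v" by simp
    have "\<phi> v = \<phi> (k *\<^sub>R \<phi> v)" by (rule arg_cong[OF eq])
    also have "\<dots> = k *\<^sub>R \<phi> (\<phi> v)" using v(1) by (intro linear_on_subspace_scale[OF linear_\<phi>]) simp
    finally have "\<phi> v = - (k *\<^sub>R v)" by (simp add: \<phi>v)
    with eq have "v = - ((k * k) *\<^sub>R v)" by (metis scaleR_minus_right scaleR_scaleR)
    then have "(1 + k * k) *\<^sub>R v = 0"
      by (simp only: scaleR_add_left scaleR_one eq_neg_iff_add_eq_0)
    moreover have "1 + k * k \<noteq> 0" by (metis add_pos_nonneg less_irrefl zero_le_square zero_less_one)
    ultimately show False using v(2) by simp
  qed
  have ind: "independent {v, \<phi> v, \<xi>}"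
    using 1 2 \<xi>_nonzero by (simp add: independent_insertI independent_empty)
  have "w \<in> span {v, \<phi> v, \<xi>}"
  proof (rule ccontr)
    assume n: "w \<notin> span {v, \<phi> v, \<xi>}"
    have "independent (insert w {v, \<phi> v, \<xi>})" using n ind by (rule independent_insertI)
    moreover have "insert w {v, \<phi> v, \<xi>} \<subseteq> span B" using B(1) v(1) w by auto
    ultimately have "card (insert w {v, \<phi> v, \<xi>}) \<le> card B"
      using independent_span_bound[OF B(2)] by blast
    moreover have "card (insert w {v, \<phi> v, \<xi>}) = 4"
    proof -
      have "w \<notin> {v, \<phi> v, \<xi>}" using n by (metis span_base)
      moreover have "v \<notin> {\<phi> v, \<xi>}" using 2 by (metis span_base)
      moreover have "\<phi> v \<noteq> \<xi>" using 1 by (metis span_base singletonI)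
      ultimately show ?thesis by simp
    qed
    ultimately show False using B(3) by simp
  qed
  then obtain x y z where "w - x *\<^sub>R v - y *\<^sub>R \<phi> v = z *\<^sub>R \<xi>"
    by (auto simp: span_breakdown_eq[of _ v] span_breakdown_eq[of _ "\<phi> v"] span_singleton)
  then have "w = x *\<^sub>R v + y *\<^sub>R \<phi> v + z *\<^sub>R \<xi>" by (simp add: algebra_simps)
  then show ?thesis by (rule that)
qed

lemma null_legendre_nonzero:
  assumes v: "v \<in> T" "v \<noteq> 0" "\<eta> v = 0" "g v v = 0"
    and B: "T \<subseteq> span B" "finite B" "card B \<le> 3"
  shows "g v (\<phi> v) \<noteq> 0"
proof
  assume 0: "g v (\<phi> v) = 0"
  have "g v w = 0" if w: "w \<in> T" for w
  proof -
    obtain x y z where "w = x *\<^sub>R v + y *\<^sub>R \<phi> v + z *\<^sub>R \<xi>"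
      using decomposition[OF v(1-3) B w] .
    then show ?thesis using v 0 by (simp add: linear_simps)
  qed
  then show False using g_nondegenerate[OF v(1)] v(2) by blast
qed

text \<open>\<phi> maps the whole space into the span of \<open>v\<close> and
  \<open>\<phi> v\<close>, to which \<open>u\<close> is orthogonal, so only the product of the
  \<eta> values survives. In effect \<open>u\<close> is the multiple \<eta>(u) of \<xi>, put in the
  form in which \<open>gt_nondegenerate\<close> is finally applied.\<close>

lemma orthogonal_null_legendre:
  assumes v: "v \<in> T" "v \<noteq> 0" "\<eta> v = 0"
    and B: "T \<subseteq> span B" "finite B" "card B \<le> 3"
    and u: "u \<in> T" "g u v = 0" "g u (\<phi> v) = 0" and w: "w \<in> T"
  shows "gt u w = \<eta> u * \<eta> w"
proof -
  obtain x y z where w': "w = x *\<^sub>R v + y *\<^sub>R \<phi> v + z *\<^sub>R \<xi>"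
    using decomposition[OF v B w] .
  have "\<phi> w = x *\<^sub>R \<phi> v - y *\<^sub>R v"
    using v by (simp add: w' linear_simps \<phi>_\<phi>)
  then show ?thesis using u v by (simp add: gt_def linear_simps)
qed

end

section \<open>Connections along curves\<close>

lemma affine_connectionD:
  assumes A: "affine_connection M nab" and U: "openin (mtop M) U" and Y: "smooth_vfield_on M U Y"
    and p: "p \<in> U"
  shows nabla_in: "v \<in> tangent_space M p \<Longrightarrow> nab p v Y \<in> tangent_space M p"
    and nabla_add: "v \<in> tangent_space M p \<Longrightarrow> smooth_vfield_on M U Z \<Longrightarrow>
      nab p v (\<lambda>q. Y q + Z q) = nab p v Y + nab p v Z"
    and nabla_leibniz: "v \<in> tangent_space M p \<Longrightarrow> smooth_fun_on M U f \<Longrightarrow>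
      nab p v (\<lambda>q. f q *\<^sub>R Y q) = v f *\<^sub>R Y p + f p *\<^sub>R nab p v Y"
    and nabla_local: "v \<in> tangent_space M p \<Longrightarrow> (\<And>q. q \<in> U \<Longrightarrow> Z q = Y q) \<Longrightarrow> nab p v Z = nab p v Y"
proof -
  note A' = A[unfolded affine_connection_def, THEN spec, THEN spec, THEN mp, OF conjI[OF U Y]]
  note P = A'[THEN conjunct2, THEN conjunct2, THEN bspec, OF p, THEN bspec]
  show "nab p v Y \<in> tangent_space M p" if v: "v \<in> tangent_space M p"
    by (rule P[OF v, THEN conjunct1])
  show "nab p v (\<lambda>q. Y q + Z q) = nab p v Y + nab p v Z"
    if v: "v \<in> tangent_space M p" and Z: "smooth_vfield_on M U Z"
    by (rule P[OF v, THEN conjunct2, THEN conjunct1, THEN spec, THEN mp, OF Z])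
  show "nab p v (\<lambda>q. f q *\<^sub>R Y q) = v f *\<^sub>R Y p + f p *\<^sub>R nab p v Y"
    if v: "v \<in> tangent_space M p" and f: "smooth_fun_on M U f"
    by (rule P[OF v, THEN conjunct2, THEN conjunct2, THEN conjunct1, THEN spec, THEN mp, OF f])
  show "nab p v Z = nab p v Y" if v: "v \<in> tangent_space M p" and Z: "\<And>q. q \<in> U \<Longrightarrow> Z q = Y q"
    by (rule P[OF v, THEN conjunct2, THEN conjunct2, THEN conjunct2, THEN spec, THEN mp])
      (simp add: Z)
qed

lemma tangent_vector_const:
  assumes "v \<in> tangent_space M p" shows "v (\<lambda>q. r) = 0"
  using assms by (auto simp: tangent_space_def velocity_def)

lemma nabla_zero:
  assumes M: "smooth_manifold M" and A: "affine_connection M nab"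
    and p: "p \<in> points M" "v \<in> tangent_space M p"
  shows "nab p v (\<lambda>q. 0) = 0"
proof -
  have "smooth_vfield_on M (points M) (\<lambda>q. 0)" by (rule smooth_vfield_on_zero[OF M order_refl])
  \<comment> \<open>The zero field is added to itself.\<close>
  from nabla_add[OF A openin_topspace this p this] show ?thesis by simp
qed

text \<open>With constant coefficients the Leibniz term drops out, because tangent vectors
  annihilate constants.\<close>

lemma nabla_sum:
  assumes M: "smooth_manifold M" and A: "affine_connection M nab"
    and U: "openin (mtop M) U" "p \<in> U" and v: "v \<in> tangent_space M p"
    and X: "\<And>i. i \<in> K \<Longrightarrow> smooth_vfield_on M U (X i)"
  shows "nab p v (\<lambda>q. \<Sum>i\<in>K. r i *\<^sub>R X i q) = (\<Sum>i\<in>K. r i *\<^sub>R nab p v (X i))"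
proof -
  have p: "p \<in> points M" "U \<subseteq> points M" using U openin_subset by blast+
  show ?thesis
    using X
  proof (induction K rule: infinite_finite_induct)
    case (insert k K)
    have k: "smooth_vfield_on M U (\<lambda>q. r k *\<^sub>R X k q)"
      using insert.prems by (intro smooth_vfield_on_scale M p) simp
    have K: "smooth_vfield_on M U (\<lambda>q. \<Sum>i\<in>K. r i *\<^sub>R X i q)"
      using insert.prems by (intro smooth_vfield_on_sum smooth_vfield_on_scale M p) simp
    have "nab p v (\<lambda>q. r k *\<^sub>R X k q) = r k *\<^sub>R nab p v (X k)"
      using nabla_leibniz[OF A U(1) insert.prems U(2) v smooth_fun_on_const[OF M U(1)]]
      by (simp add: tangent_vector_const[OF v])
    moreover have "nab p v (\<lambda>q. \<Sum>i\<in>K. r i *\<^sub>R X i q) = (\<Sum>i\<in>K. r i *\<^sub>R nab p v (X i))"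
      using insert.prems by (intro insert.IH) simp
    ultimately show ?case
      using nabla_add[OF A U(1) k U(2) v K] by (simp only: sum.insert[OF insert.hyps])
  qed (simp_all add: nabla_zero[OF M A p(1) v])
qed

lemma smooth_near_I: "openin (mtop M) U \<Longrightarrow> p \<in> U \<Longrightarrow> smooth_fun_on M U f \<Longrightarrow> smooth_near M p f"
  unfolding smooth_near_def by blast

lemma tensor02_smooth:
  "tensor02 M B \<Longrightarrow> openin (mtop M) U \<Longrightarrow> smooth_vfield_on M U X \<Longrightarrow> smooth_vfield_on M U Y \<Longrightarrow>
    smooth_fun_on M U (\<lambda>p. B p (X p) (Y p))"
  by (simp add: tensor02_def)

lemma one_form_smooth:
  "one_form M B \<Longrightarrow> openin (mtop M) U \<Longrightarrow> smooth_vfield_on M U X \<Longrightarrow>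
    smooth_fun_on M U (\<lambda>p. B p (X p))"
  by (simp add: one_form_def)

section \<open>The velocity field of a curve in one chart\<close>

context manifold_chart
begin

text \<open>Extends a tangent vector over the whole chart domain with constant components, which
  provides a smooth field for the connections to act on.\<close>

definition const_field :: "real ^ 'n \<Rightarrow> 'a vfield" where "const_field c q = (\<Sum>i\<in>UNIV. c $ i *\<^sub>R del i q)"

text \<open>Components are read off by applying the velocity to the coordinate functions, the form
  in which they occur in \<open>cov_deriv_along\<close>.\<close>

definition comps :: "(real \<Rightarrow> 'a) \<Rightarrow> real \<Rightarrow> real ^ 'n" where
  "comps C s = (\<chi> i. velocity M C s (coord i))"

text \<open>The contribution of the changing components to the covariant derivative of the velocity.
  It depends on the chart but on no connection.\<close>

definition accel :: "(real \<Rightarrow> 'a) \<Rightarrow> real \<Rightarrow> 'a tvec" where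
  "accel C t = (\<Sum>i\<in>UNIV. deriv (\<lambda>s. comps C s $ i) t *\<^sub>R del i (C t))"

lemma del_in: "p \<in> D \<Longrightarrow> del i p \<in> tangent_space M p"
  by (simp add: tangent_space_eq_span span_base)

lemma smooth_vfield_const_field: "smooth_vfield_on M D (const_field c)"
  unfolding const_field_def
  by (intro smooth_vfield_on_sum smooth_vfield_on_scale manifold D_points smooth_vfield_del)

lemma accel_in: "C t \<in> D \<Longrightarrow> accel C t \<in> tangent_space M (C t)"
  unfolding accel_def by (simp add: tangent_space_eq_span span_sum span_scale span_base)

lemma velocity_eq_const_field:
  assumes "smooth_curve M I C" "t \<in> I" "C t \<in> D"
  shows "velocity M C t = const_field (comps C t) (C t)"
proof -
  have "velocity M C t (coord i) = deriv (\<lambda>s. coord i (C s)) t" for i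
    using smooth_near_coord[OF assms(3)] by (simp add: velocity_def)
  then show ?thesis
    using velocity_eq[OF assms] by (simp only: const_field_def comps_def vec_lambda_beta)
qed

text \<open>The components are first derivatives of the coordinates along the curve; smoothness of
  the curve allows one more derivative.\<close>

lemma comps_derivative:
  assumes C: "smooth_curve M I C" and t: "t \<in> I" "C t \<in> D"
  shows "((\<lambda>s. comps C s $ i) has_real_derivative deriv (\<lambda>s. comps C s $ i) t) (at t)"
proof -
  let ?N = "{s \<in> I. C s \<in> D}" and ?f = "\<lambda>s. coord i (C s)"
  have o: "open ?N" using C openin_D by (rule open_curve_preimage)
  have "smooth_on ?N (\<lambda>s. \<psi> (C s))"
    using C chart unfolding smooth_curve_def comp_def by blast
  then have f: "smooth_on ?N ?f"
    by (rule smooth_on_bounded_linear[OF o bounded_linear_vec_nth])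
  have eq: "frechet_derivative ?f (at s) 1 = comps C s $ i" if s: "s \<in> ?N" for s
  proof -
    have "?f field_differentiable at s" using curve_coord_derivative(2)[OF C] s by simp
    then have "(?f has_real_derivative deriv ?f s) (at s)"
      by (simp add: DERIV_deriv_iff_field_differentiable)
    then have "(*) (deriv ?f s) = frechet_derivative ?f (at s)"
      unfolding has_field_derivative_def by (rule frechet_derivative_at)
    then have "frechet_derivative ?f (at s) 1 = deriv ?f s" by (metis mult_1_right)
    then show ?thesis using s smooth_near_coord by (simp add: comps_def velocity_def)
  qed
  have "smooth_on ?N (\<lambda>s. comps C s $ i)"
    by (rule smooth_on_transform[OF o smooth_on_frechet_derivative[OF f, of 1] eq])
  then have "(\<lambda>s. comps C s $ i) differentiable at t"
    by (rule smooth_on_differentiable) (use t in simp)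
  then show ?thesis
    by (simp add: DERIV_deriv_iff_real_differentiable)
qed

text \<open>Linearity over constant coefficients collapses the sum over coordinate fields into the
  connection applied to one frozen field, leaving \<open>accel\<close> as the part shared by all
  connections.\<close>

lemma cov_deriv_along_eq:
  assumes A: "affine_connection M nab" and C: "smooth_curve M I C" and t: "t \<in> I" "C t \<in> D"
  shows "cov_deriv_along M nab (D, \<psi>) C (velocity M C) t
    = accel C t + nab (C t) (velocity M C t) (const_field (comps C t))"
proof -
  have "nab (C t) (velocity M C t) (\<lambda>q. \<Sum>i\<in>UNIV. comps C t $ i *\<^sub>R del i q)
      = (\<Sum>i\<in>UNIV. comps C t $ i *\<^sub>R nab (C t) (velocity M C t) (del i))"
    by (rule nabla_sum[OF manifold A openin_D t(2) velocity_in_tangent_space[OF manifold C t(1)]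
          smooth_vfield_del])
  moreover have "const_field (comps C t) = (\<lambda>q. \<Sum>i\<in>UNIV. comps C t $ i *\<^sub>R del i q)"
    by (rule ext) (simp only: const_field_def)
  ultimately show ?thesis
    by (simp only: cov_deriv_along_def accel_def comps_def sum.distrib vec_lambda_beta snd_conv)
qed

lemma tensor02_const_field:
  assumes B: "tensor02 M B" and q: "q \<in> D"
  shows "B q (const_field c q) (const_field d q) = (\<Sum>i\<in>UNIV. \<Sum>j\<in>UNIV. c $ i * d $ j * B q (del i q) (del j q))"
proof -
  have p: "q \<in> points M" using q D_points by blast
  have T: "subspace (tangent_space M q)" using manifold p by (rule subspace_tangent_space)
  have e: "const_field c q \<in> tangent_space M q" for c
    using smooth_vfield_const_field q by (auto simp: smooth_vfield_on_def)
  have L: "linear_on_subspace (tangent_space M q) (B q v)"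
    "linear_on_subspace (tangent_space M q) (\<lambda>w. B q w v)" if "v \<in> tangent_space M q" for v
    using B p that by (auto simp: tensor02_def)
  have "B q (const_field c q) (const_field d q) = (\<Sum>i\<in>UNIV. c $ i *\<^sub>R B q (del i q) (const_field d q))"
    unfolding const_field_def[of c]
    by (rule linear_on_subspace_sum[OF L(2)[OF e] T]) (simp add: del_in q)
  also have "\<dots> = (\<Sum>i\<in>UNIV. c $ i *\<^sub>R (\<Sum>j\<in>UNIV. d $ j *\<^sub>R B q (del i q) (del j q)))"
    unfolding const_field_def[of d]
    by (intro sum.cong refl arg_cong[where f = "\<lambda>x. _ *\<^sub>R x"] linear_on_subspace_sum[OF L(1) T])
      (simp_all add: del_in q)
  finally show ?thesis by (simp add: sum_distrib_left mult.assoc)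
qed

lemma one_form_const_field:
  assumes B: "one_form M B" and q: "q \<in> D"
  shows "B q (const_field c q) = (\<Sum>i\<in>UNIV. c $ i * B q (del i q))"
proof -
  have p: "q \<in> points M" using q D_points by blast
  have T: "subspace (tangent_space M q)" using manifold p by (rule subspace_tangent_space)
  have "linear_on_subspace (tangent_space M q) (B q)" using B p by (auto simp: one_form_def)
  then have "B q (const_field c q) = (\<Sum>i\<in>UNIV. c $ i *\<^sub>R B q (del i q))"
    unfolding const_field_def by (rule linear_on_subspace_sum[OF _ T]) (simp add: del_in q)
  then show ?thesis by simp
qed

text \<open>Freezing the components of the velocity at time \<open>t\<close> splits off the derivative of the
  coefficients of the tensor, which can then be expressed through a connection.\<close>

lemma tensor02_curve_derivative:
  assumes B: "tensor02 M B" and C: "smooth_curve M I C" and t: "t \<in> I" "C t \<in> D"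
  defines "X \<equiv> const_field (comps C t)"
  shows "((\<lambda>s. B (C s) (velocity M C s) (velocity M C s)) has_real_derivative
    B (C t) (accel C t) (velocity M C t) + B (C t) (velocity M C t) (accel C t)
      + velocity M C t (\<lambda>q. B q (X q) (X q))) (at t)"
proof -
  let ?N = "{s \<in> I. C s \<in> D}" and ?B = "\<lambda>i j q. B q (del i q) (del j q)"
  let ?c = "comps C" and ?v = "velocity M C t"
  let ?c' = "\<chi> i. deriv (\<lambda>s. comps C s $ i) t"
  have o: "open ?N" using C openin_D by (rule open_curve_preimage)
  have tN: "t \<in> ?N" using t by simp
  have acc: "accel C t = const_field ?c' (C t)" by (simp add: accel_def const_field_def)
  have D: "((\<lambda>s. h (C s)) has_real_derivative ?v h) (at t)" if "smooth_fun_on M D h" for h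
    using manifold C t(1) by (rule has_real_derivative_velocity)
      (use smooth_near_I[OF openin_D t(2) that] in simp)
  have dB: "((\<lambda>s. ?B i j (C s)) has_real_derivative ?v (?B i j)) (at t)" for i j
    by (rule D) (use B openin_D smooth_vfield_del in \<open>simp add: tensor02_smooth\<close>)
  have dc: "((\<lambda>s. ?c s $ i) has_real_derivative ?c' $ i) (at t)" for i
    using comps_derivative[OF C t] by simp
  have dX: "((\<lambda>s. B (C s) (X (C s)) (X (C s))) has_real_derivative ?v (\<lambda>q. B q (X q) (X q))) (at t)"
    by (rule D) (use B openin_D smooth_vfield_const_field in \<open>simp add: tensor02_smooth X_def\<close>)
  have "((\<lambda>s. \<Sum>i\<in>UNIV. \<Sum>j\<in>UNIV. ?c t $ i * ?c t $ j * ?B i j (C s)) has_real_derivative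
      (\<Sum>i\<in>UNIV. \<Sum>j\<in>UNIV. ?c t $ i * ?c t $ j * ?v (?B i j))) (at t)"
    by (intro DERIV_sum DERIV_cmult dB)
  then have "((\<lambda>s. B (C s) (X (C s)) (X (C s))) has_real_derivative
      (\<Sum>i\<in>UNIV. \<Sum>j\<in>UNIV. ?c t $ i * ?c t $ j * ?v (?B i j))) (at t)"
    by (rule has_field_derivative_transform_within_open[OF _ o tN])
      (simp add: X_def tensor02_const_field[OF B])
  \<comment> \<open>The same function of the parameter is differentiated in two ways; uniqueness
    turns the action of the velocity on B(X, X) into a sum over the entries of
    \<open>B\<close>.\<close>
  with dX have vX: "?v (\<lambda>q. B q (X q) (X q)) = (\<Sum>i\<in>UNIV. \<Sum>j\<in>UNIV. ?c t $ i * ?c t $ j * ?v (?B i j))"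
    by (rule DERIV_unique)
  have B1: "B (C t) (accel C t) ?v = (\<Sum>i\<in>UNIV. \<Sum>j\<in>UNIV. ?c' $ i * ?c t $ j * ?B i j (C t))"
    by (simp only: acc velocity_eq_const_field[OF C t] tensor02_const_field[OF B t(2)])
  have B2: "B (C t) ?v (accel C t) = (\<Sum>i\<in>UNIV. \<Sum>j\<in>UNIV. ?c t $ i * ?c' $ j * ?B i j (C t))"
    by (simp only: acc velocity_eq_const_field[OF C t] tensor02_const_field[OF B t(2)])
  have "((\<lambda>s. \<Sum>i\<in>UNIV. \<Sum>j\<in>UNIV. ?c s $ i * ?c s $ j * ?B i j (C s)) has_real_derivative
      (\<Sum>i\<in>UNIV. \<Sum>j\<in>UNIV. (?c' $ i * ?c t $ j + ?c' $ j * ?c t $ i) * ?B i j (C t)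
        + ?v (?B i j) * (?c t $ i * ?c t $ j))) (at t)"
    by (intro DERIV_sum DERIV_mult dB dc)
  then have "((\<lambda>s. B (C s) (velocity M C s) (velocity M C s)) has_real_derivative
      (\<Sum>i\<in>UNIV. \<Sum>j\<in>UNIV. (?c' $ i * ?c t $ j + ?c' $ j * ?c t $ i) * ?B i j (C t)
        + ?v (?B i j) * (?c t $ i * ?c t $ j))) (at t)"
    by (rule has_field_derivative_transform_within_open[OF _ o tN])
      (simp add: velocity_eq_const_field[OF C] tensor02_const_field[OF B])
  moreover have "(\<Sum>i\<in>UNIV. \<Sum>j\<in>UNIV. (?c' $ i * ?c t $ j + ?c' $ j * ?c t $ i) * ?B i j (C t)
        + ?v (?B i j) * (?c t $ i * ?c t $ j))
    = B (C t) (accel C t) ?v + B (C t) ?v (accel C t) + ?v (\<lambda>q. B q (X q) (X q))"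
    unfolding vX B1 B2 sum.distrib[symmetric]
    by (intro sum.cong refl) (simp add: algebra_simps)
  ultimately show ?thesis by simp
qed

text \<open>The freezing argument again, with a single index; needed for \<eta>(V).\<close>

lemma one_form_curve_derivative:
  assumes B: "one_form M B" and C: "smooth_curve M I C" and t: "t \<in> I" "C t \<in> D"
  defines "X \<equiv> const_field (comps C t)"
  shows "((\<lambda>s. B (C s) (velocity M C s)) has_real_derivative
    B (C t) (accel C t) + velocity M C t (\<lambda>q. B q (X q))) (at t)"
proof -
  let ?N = "{s \<in> I. C s \<in> D}" and ?B = "\<lambda>i q. B q (del i q)"
  let ?c = "comps C" and ?v = "velocity M C t"
  let ?c' = "\<chi> i. deriv (\<lambda>s. comps C s $ i) t"
  have o: "open ?N" using C openin_D by (rule open_curve_preimage)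
  have tN: "t \<in> ?N" using t by simp
  have acc: "accel C t = const_field ?c' (C t)" by (simp add: accel_def const_field_def)
  have D: "((\<lambda>s. h (C s)) has_real_derivative ?v h) (at t)" if "smooth_fun_on M D h" for h
    using manifold C t(1) by (rule has_real_derivative_velocity)
      (use smooth_near_I[OF openin_D t(2) that] in simp)
  have dB: "((\<lambda>s. ?B i (C s)) has_real_derivative ?v (?B i)) (at t)" for i
    by (rule D) (use B openin_D smooth_vfield_del in \<open>simp add: one_form_smooth\<close>)
  have dc: "((\<lambda>s. ?c s $ i) has_real_derivative ?c' $ i) (at t)" for i
    using comps_derivative[OF C t] by simp
  have dX: "((\<lambda>s. B (C s) (X (C s))) has_real_derivative ?v (\<lambda>q. B q (X q))) (at t)"
    by (rule D) (use B openin_D smooth_vfield_const_field in \<open>simp add: one_form_smooth X_def\<close>)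
  have "((\<lambda>s. \<Sum>i\<in>UNIV. ?c t $ i * ?B i (C s)) has_real_derivative
      (\<Sum>i\<in>UNIV. ?c t $ i * ?v (?B i))) (at t)"
    by (intro DERIV_sum DERIV_cmult dB)
  then have "((\<lambda>s. B (C s) (X (C s))) has_real_derivative
      (\<Sum>i\<in>UNIV. ?c t $ i * ?v (?B i))) (at t)"
    by (rule has_field_derivative_transform_within_open[OF _ o tN])
      (simp add: X_def one_form_const_field[OF B])
  with dX have vX: "?v (\<lambda>q. B q (X q)) = (\<Sum>i\<in>UNIV. ?c t $ i * ?v (?B i))"
    by (rule DERIV_unique)
  have "((\<lambda>s. \<Sum>i\<in>UNIV. ?c s $ i * ?B i (C s)) has_real_derivative
      (\<Sum>i\<in>UNIV. ?c' $ i * ?B i (C t) + ?v (?B i) * ?c t $ i)) (at t)"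
    by (intro DERIV_sum DERIV_mult dB dc)
  then have "((\<lambda>s. B (C s) (velocity M C s)) has_real_derivative
      (\<Sum>i\<in>UNIV. ?c' $ i * ?B i (C t) + ?v (?B i) * ?c t $ i)) (at t)"
    by (rule has_field_derivative_transform_within_open[OF _ o tN])
      (simp add: velocity_eq_const_field[OF C] one_form_const_field[OF B])
  moreover have "(\<Sum>i\<in>UNIV. ?c' $ i * ?B i (C t) + ?v (?B i) * ?c t $ i)
    = B (C t) (accel C t) + ?v (\<lambda>q. B q (X q))"
    unfolding vX acc one_form_const_field[OF B t(2)] sum.distrib[symmetric]
    by (intro sum.cong refl) (simp add: algebra_simps)
  ultimately show ?thesis by simp
qed

end

section \<open>The Levi-Civita connections of the two B-metrics\<close>

locale F4_manifold =
  fixes M :: "('a, 3) manifold"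
    and \<phi> :: "'a \<Rightarrow> 'a tvec \<Rightarrow> 'a tvec"
    and \<xi> :: "'a vfield"
    and \<eta> :: "'a \<Rightarrow> 'a tvec \<Rightarrow> real"
    and g :: "'a \<Rightarrow> 'a tvec \<Rightarrow> 'a tvec \<Rightarrow> real"
    and nabla nabla' :: "'a connection"
  assumes acB: "almost_contact_B_metric_manifold M \<phi> \<xi> \<eta> g"
    and lc: "levi_civita M g nabla"
    and lc': "levi_civita M (associated_metric \<phi> \<eta> g) nabla'"
    and F4: "F4_condition M \<phi> \<xi> \<eta> g nabla"
begin

abbreviation G :: "'a \<Rightarrow> 'a tvec \<Rightarrow> 'a tvec \<Rightarrow> real" where "G \<equiv> associated_metric \<phi> \<eta> g"

abbreviation F where "F \<equiv> fundamental_F \<phi> g nabla"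

abbreviation T where "T \<equiv> tangent_space M"

lemma manifold: "smooth_manifold M"
  and tensor_\<phi>: "tensor11 M \<phi>" and smooth_\<xi>: "smooth_vfield_on M (points M) \<xi>"
  and form_\<eta>: "one_form M \<eta>" and metric_g: "semi_riemannian_metric M g"
  using acB by (simp_all add: almost_contact_B_metric_manifold_def)

lemma tensor_g: "tensor02 M g"
  using metric_g by (simp add: semi_riemannian_metric_def)

lemma affine: "affine_connection M nabla" and affine': "affine_connection M nabla'"
  using lc lc' by (simp_all add: levi_civita_def)

lemma contact_B_space:
  assumes p: "p \<in> points M" shows "contact_B_space (T p) (g p) (\<phi> p) (\<xi> p) (\<eta> p)"
proof
  show "subspace (T p)" using manifold p by (rule subspace_tangent_space)
  show "linear_on_subspace (T p) (\<phi> p)" using tensor_\<phi> p by (simp add: tensor11_def)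
  show "\<phi> p v \<in> T p" if "v \<in> T p" for v using tensor_\<phi> p that by (auto simp: tensor11_def)
  show "linear_on_subspace (T p) (\<eta> p)" using form_\<eta> p by (simp add: one_form_def)
  show "\<xi> p \<in> T p" using smooth_\<xi> p by (simp add: smooth_vfield_on_def)
  show "linear_on_subspace (T p) (g p v)" "linear_on_subspace (T p) (\<lambda>w. g p w v)"
    if "v \<in> T p" for v using tensor_g p that by (simp_all add: tensor02_def)
  show "g p v w = g p w v" if "v \<in> T p" "w \<in> T p" for v w
    using metric_g p that by (simp add: semi_riemannian_metric_def)
  show "v = 0" if "v \<in> T p" "\<And>w. w \<in> T p \<Longrightarrow> g p v w = 0" for v
    using metric_g p that by (simp add: semi_riemannian_metric_def)
  show "\<eta> p (\<xi> p) = 1"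
    using acB p by (simp add: almost_contact_B_metric_manifold_def)
  show "\<phi> p (\<phi> p v) = - v + \<eta> p v *\<^sub>R \<xi> p" if "v \<in> T p" for v
    using acB p that by (simp only: almost_contact_B_metric_manifold_def)
  show "g p (\<phi> p v) (\<phi> p w) = - g p v w + \<eta> p v * \<eta> p w" if "v \<in> T p" "w \<in> T p" for v w
    using acB p that by (simp add: almost_contact_B_metric_manifold_def)
qed

lemma smooth_\<phi>:
  "openin (mtop M) U \<Longrightarrow> smooth_vfield_on M U X \<Longrightarrow> smooth_vfield_on M U (\<lambda>q. \<phi> q (X q))"
  using tensor_\<phi> by (simp add: tensor11_def)

lemma smooth_vfield_in: "smooth_vfield_on M U X \<Longrightarrow> p \<in> U \<Longrightarrow> X p \<in> T p"
  by (simp add: smooth_vfield_on_def)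

lemma torsion_free:
  assumes L: "levi_civita M h nab"
    and U: "openin (mtop M) U" "smooth_vfield_on M U X" "smooth_vfield_on M U Y" "smooth_fun_on M U f"
    and p: "p \<in> U"
  shows "nab p (X p) Y f - nab p (Y p) X f = X p (\<lambda>q. Y q f) - Y p (\<lambda>q. X q f)"
  using L[unfolded levi_civita_def, THEN conjunct2, THEN conjunct1] U p by blast

lemma metric_compatible:
  assumes L: "levi_civita M h nab"
    and U: "openin (mtop M) U" "smooth_vfield_on M U X" "smooth_vfield_on M U Y" "smooth_vfield_on M U Z"
    and p: "p \<in> U"
  shows "X p (\<lambda>q. h q (Y q) (Z q)) = h p (nab p (X p) Y) (Z p) + h p (Y p) (nab p (X p) Z)"
  using L[unfolded levi_civita_def, THEN conjunct2, THEN conjunct2] U p by blast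

text \<open>Both sides are the bracket of \<open>X\<close> and \<open>Y\<close>, which involves no
  metric. Torsion freeness speaks of functions smooth on the common open set, hence the shrinking to
  \<open>U \<inter> V\<close>; on functions not smooth near \<open>p\<close> every tangent vector
  gives 0.\<close>

lemma torsion_eq:
  assumes U: "openin (mtop M) U" "smooth_vfield_on M U X" "smooth_vfield_on M U Y" and p: "p \<in> U"
  shows "nabla p (X p) Y - nabla p (Y p) X = nabla' p (X p) Y - nabla' p (Y p) X"
proof
  fix f
  have in_T: "nabla p (X p) Y \<in> T p" "nabla p (Y p) X \<in> T p"
    "nabla' p (X p) Y \<in> T p" "nabla' p (Y p) X \<in> T p"
    using nabla_in[OF affine U(1)] nabla_in[OF affine' U(1)] U p smooth_vfield_in by blast+
  show "(nabla p (X p) Y - nabla p (Y p) X) f = (nabla' p (X p) Y - nabla' p (Y p) X) f"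
  proof (cases "smooth_near M p f")
    case True
    then obtain V where V: "openin (mtop M) V" "p \<in> V" "smooth_fun_on M V f"
      unfolding smooth_near_def by blast
    have W: "openin (mtop M) (U \<inter> V)" "p \<in> U \<inter> V" "smooth_fun_on M (U \<inter> V) f"
      using V U p smooth_fun_on_subset[of M V f "U \<inter> V"] by auto
    have XY: "smooth_vfield_on M (U \<inter> V) X" "smooth_vfield_on M (U \<inter> V) Y"
      using U smooth_vfield_on_subset[of M U _ "U \<inter> V"] by auto
    show ?thesis
      using torsion_free[OF lc W(1) XY W(3,2)] torsion_free[OF lc' W(1) XY W(3,2)] by simp
  next
    case False
    then show ?thesis using in_T by (simp add: tangent_vector_not_smooth)
  qed
qed

text \<open>The second summand of the associated metric is \<open>\<eta>(v) \<eta>(w) = g(v, w) + g(\<phi> v, \<phi> w)\<close>,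
  so that its derivative is again expressed by \<open>F\<close>.\<close>

lemma derivative_associated_metric:
  assumes U: "openin (mtop M) U" "smooth_vfield_on M U X" "smooth_vfield_on M U Y"
    "smooth_vfield_on M U Z" and p: "p \<in> U"
  shows "X p (\<lambda>q. G q (Y q) (Z q)) = G p (nabla p (X p) Y) (Z p) + G p (Y p) (nabla p (X p) Z)
    + F X Z Y p + F X Y (\<lambda>q. \<phi> q (Z q)) p + F X Z (\<lambda>q. \<phi> q (Y q)) p"
proof -
  let ?Y = "\<lambda>q. \<phi> q (Y q)" and ?Z = "\<lambda>q. \<phi> q (Z q)"
  have UM: "q \<in> points M" if "q \<in> U" for q using openin_subset[OF U(1)] that by blast
  note sY = smooth_\<phi>[OF U(1,3)] and sZ = smooth_\<phi>[OF U(1,4)]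
  note X = smooth_vfield_in[OF U(2) p] and Y = smooth_vfield_in[OF U(3) p]
    and Z = smooth_vfield_in[OF U(4) p]
  note n_in = nabla_in[OF affine U(1) _ p X]
  have "X p (\<lambda>q. G q (Y q) (Z q))
      = X p (\<lambda>q. g q (Y q) (?Z q) + g q (Y q) (Z q) + g q (?Y q) (?Z q))"
    using manifold X U(1) p
  proof (rule tangent_vector_transform)
    fix q assume q: "q \<in> U"
    interpret contact_B_space "T q" "g q" "\<phi> q" "\<xi> q" "\<eta> q" by (rule contact_B_space[OF UM[OF q]])
    show "associated_metric \<phi> \<eta> g q (Y q) (Z q) = g q (Y q) (?Z q) + g q (Y q) (Z q) + g q (?Y q) (?Z q)"
      using gt_eq[OF smooth_vfield_in[OF U(3) q] smooth_vfield_in[OF U(4) q]]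
      by (simp add: associated_metric_def gt_def)
  qed
  also have "\<dots> = X p (\<lambda>q. g q (Y q) (?Z q)) + X p (\<lambda>q. g q (Y q) (Z q)) + X p (\<lambda>q. g q (?Y q) (?Z q))"
    using tangent_vector_add[OF manifold X U(1) p] smooth_fun_on_add[OF manifold U(1)]
      tensor02_smooth[OF tensor_g U(1)] U sY sZ by simp
  also have "\<dots> = g p (nabla p (X p) Y) (?Z p) + g p (Y p) (nabla p (X p) ?Z)
      + (g p (nabla p (X p) Y) (Z p) + g p (Y p) (nabla p (X p) Z))
      + (g p (nabla p (X p) ?Y) (?Z p) + g p (?Y p) (nabla p (X p) ?Z))"
    by (simp only: metric_compatible[OF lc U(1,2,3) sZ p] metric_compatible[OF lc U(1,2,3,4) p]
        metric_compatible[OF lc U(1,2) sY sZ p])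
  finally have *: "X p (\<lambda>q. G q (Y q) (Z q)) = \<dots>" .
  interpret contact_B_space "T p" "g p" "\<phi> p" "\<xi> p" "\<eta> p" by (rule contact_B_space[OF UM[OF p]])
  have assoc: "associated_metric \<phi> \<eta> g p = gt" by (simp add: associated_metric_def gt_def fun_eq_iff)
  note in_T' = Y Z n_in[OF U(3)] n_in[OF U(4)] n_in[OF sY] n_in[OF sZ]
  \<comment> \<open>By the symmetries of \<open>g\<close> and of g(., \<phi> .), the surplus terms
    pair up into differences between the derivative of \<phi> Y and \<phi> of the derivative of Y
    (and likewise for Z), that is, into values of \<open>F\<close>.\<close>
  show ?thesis
    unfolding *
    using in_T' g_sym[OF Y n_in[OF sZ]] g_sym[OF \<phi>_in[OF Y] n_in[OF sZ]]
      g_sym[OF Y \<phi>_in[OF n_in[OF U(4)]]] g_sym[OF \<phi>_in[OF Y] \<phi>_in[OF n_in[OF U(4)]]]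
    by (simp add: fundamental_F_def assoc gt_eq linear_simps)
qed

text \<open>The proof uses the cyclic permutation of the Koszul formula.\<close>

lemma nabla'_diagonal:
  assumes U: "openin (mtop M) U" "local_frame M U e" "smooth_vfield_on M U X" "smooth_vfield_on M U Z"
    and p: "p \<in> U" and X: "\<eta> p (X p) = 0" "g p (X p) (X p) = 0"
  shows "G p (nabla' p (X p) X) (Z p) = G p (nabla p (X p) X) (Z p)
    + lee_theta \<phi> g nabla e \<xi> p / 2 * g p (X p) (\<phi> p (X p)) * \<eta> p (Z p)"
proof -
  let ?X = "\<lambda>q. \<phi> q (X q)" and ?Z = "\<lambda>q. \<phi> q (Z q)"
  have "p \<in> points M" using openin_subset[OF U(1)] p by blast
  then interpret contact_B_space "T p" "g p" "\<phi> p" "\<xi> p" "\<eta> p" by (rule contact_B_space)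
  have assoc: "associated_metric \<phi> \<eta> g p = gt" by (simp add: associated_metric_def gt_def fun_eq_iff)
  note sX = smooth_\<phi>[OF U(1,3)] and sZ = smooth_\<phi>[OF U(1,4)]
  note x = smooth_vfield_in[OF U(3) p] and z = smooth_vfield_in[OF U(4) p]
  note n = nabla_in[OF affine U(1,3) p x] nabla_in[OF affine U(1,4) p x] nabla_in[OF affine U(1,3) p z]
  note n' = nabla_in[OF affine' U(1,3) p x] nabla_in[OF affine' U(1,4) p x] nabla_in[OF affine' U(1,3) p z]
  have F: "F A B E p = - (lee_theta \<phi> g nabla e \<xi> p / 2) * (g p (\<phi> p (A p)) (\<phi> p (B p)) * \<eta> p (E p) +
        g p (\<phi> p (A p)) (\<phi> p (E p)) * \<eta> p (B p))"
    if "smooth_vfield_on M U A" "smooth_vfield_on M U B" "smooth_vfield_on M U E" for A B E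
    using F4[unfolded F4_condition_def] U(1,2) that p by blast
  have xx: "g p (\<phi> p (X p)) (\<phi> p (X p)) = 0" using x X by (simp add: g_\<phi>_\<phi>)
  have xxx: "g p (\<phi> p (X p)) (\<phi> p (\<phi> p (X p))) = - g p (X p) (\<phi> p (X p))"
    using x X by (simp add: g_\<phi>_\<phi>)
  \<comment> \<open>Of the three values of \<open>F\<close> only F(X, Z, \<phi> X) survives, because
    \<open>X p\<close> is null and in the kernel of \<eta>. It produces the \<theta>(\<xi>)
    term.\<close>
  have "gt (nabla' p (X p) X) (Z p) + gt (X p) (nabla' p (X p) Z)
      = gt (nabla p (X p) X) (Z p) + gt (X p) (nabla p (X p) Z)
        + lee_theta \<phi> g nabla e \<xi> p / 2 * g p (X p) (\<phi> p (X p)) * \<eta> p (Z p)"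
    using metric_compatible[OF lc' U(1,3,3,4) p] derivative_associated_metric[OF U(1,3,3,4) p]
      F[OF U(3,4,3)] F[OF U(3,3) sZ] F[OF U(3,4) sX] X xx xxx x z
    by (simp add: assoc)
  \<comment> \<open>With \<open>X\<close> in both metric slots every term of the condition on
    \<open>F\<close> carries a factor \<eta>(X) or \<eta>(\<phi> X), so the two connections agree
    here.\<close>
  moreover have "gt (nabla' p (Z p) X) (X p) + gt (X p) (nabla' p (Z p) X)
      = gt (nabla p (Z p) X) (X p) + gt (X p) (nabla p (Z p) X)"
    using metric_compatible[OF lc' U(1,4,3,3) p] derivative_associated_metric[OF U(1,4,3,3) p]
      F[OF U(4,3,3)] F[OF U(4,3) sX] X x by (simp add: assoc)
  then have "gt (X p) (nabla' p (Z p) X) = gt (X p) (nabla p (Z p) X)"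
    using gt_sym[OF x n(3)] gt_sym[OF x n'(3)] by simp
  \<comment> \<open>Equal torsion trades the derivatives of \<open>Z\<close> along \<open>X\<close>
    for those of \<open>X\<close> along \<open>Z\<close>, on which the connections were just seen to
    agree.\<close>
  moreover have "gt (X p) (nabla p (X p) Z) - gt (X p) (nabla p (Z p) X)
      = gt (X p) (nabla' p (X p) Z) - gt (X p) (nabla' p (Z p) X)"
    using torsion_eq[OF U(1,3,4) p] gt_linear(4)[OF n(2,3) x] gt_linear(4)[OF n'(2,3) x] by simp
  ultimately show ?thesis by (simp add: assoc)
qed

text \<open>As \<phi> \<xi> = 0, the value F(X, \<xi>, \<phi> X) reduces to -g(\<phi> W, \<phi> X),
  where W is the derivative of \<xi> along \<open>X\<close>. Compatibility and \<eta>(X) = 0 make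
  this g(X, W), while \<open>F4_condition\<close> evaluates the same value of
  \<open>F\<close>.\<close>

lemma nabla_\<xi>:
  assumes U: "openin (mtop M) U" "local_frame M U e" "smooth_vfield_on M U X"
    and p: "p \<in> U" and X: "\<eta> p (X p) = 0"
  shows "g p (X p) (nabla p (X p) \<xi>) = lee_theta \<phi> g nabla e \<xi> p / 2 * g p (X p) (\<phi> p (X p))"
proof -
  have UM: "U \<subseteq> points M" using openin_subset[OF U(1)] .
  then have pM: "p \<in> points M" using p by blast
  interpret contact_B_space "T p" "g p" "\<phi> p" "\<xi> p" "\<eta> p" by (rule contact_B_space[OF pM])
  have s\<xi>: "smooth_vfield_on M U \<xi>" using smooth_\<xi> UM by (rule smooth_vfield_on_subset)
  note sX = smooth_\<phi>[OF U(1,3)] and x = smooth_vfield_in[OF U(3) p]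
  note n = nabla_in[OF affine U(1) s\<xi> p x]
  \<comment> \<open>The field \<phi> \<xi> is known to vanish on \<open>U\<close> only, so the
    locality clause is what replaces it by the zero field.\<close>
  have "nabla p (X p) (\<lambda>q. \<phi> q (\<xi> q)) = nabla p (X p) (\<lambda>q. 0)"
    using UM contact_B_space.\<phi>_\<xi>[OF contact_B_space]
    by (intro nabla_local[OF affine U(1) smooth_vfield_on_zero[OF manifold UM] p x]) blast
  then have "nabla p (X p) (\<lambda>q. \<phi> q (\<xi> q)) = 0"
    using nabla_zero[OF manifold affine pM x] by simp
  then have "F X \<xi> (\<lambda>q. \<phi> q (X q)) p = g p (X p) (nabla p (X p) \<xi>)"
    using x n X g_sym[OF x n] by (simp add: fundamental_F_def linear_simps g_\<phi>_\<phi>)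
  moreover have "F X \<xi> (\<lambda>q. \<phi> q (X q)) p = - (lee_theta \<phi> g nabla e \<xi> p / 2) *
      (g p (\<phi> p (X p)) (\<phi> p (\<xi> p)) * \<eta> p (\<phi> p (X p)) +
       g p (\<phi> p (X p)) (\<phi> p (\<phi> p (X p))) * \<eta> p (\<xi> p))"
    using F4[unfolded F4_condition_def] U s\<xi> sX p by blast
  ultimately show ?thesis using x X by (simp add: g_\<phi>_\<phi>)
qed

text \<open>Makes g(V, \<phi> V) accessible to \<open>tensor02_curve_derivative\<close>.\<close>

lemma tensor_g\<phi>: "tensor02 M (\<lambda>p v w. g p v (\<phi> p w))"
  unfolding tensor02_def
proof (intro conjI ballI allI impI)
  fix p v assume p: "p \<in> points M" and v: "v \<in> T p"
  interpret contact_B_space "T p" "g p" "\<phi> p" "\<xi> p" "\<eta> p" by (rule contact_B_space[OF p])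
  show "linear_on_subspace (T p) (\<lambda>w. g p v (\<phi> p w))" "linear_on_subspace (T p) (\<lambda>w. g p w (\<phi> p v))"
    using v by (auto simp: linear_on_subspace_def linear_simps)
next
  fix U X Y assume "openin (mtop M) U \<and> smooth_vfield_on M U X \<and> smooth_vfield_on M U Y"
  then show "smooth_fun_on M U (\<lambda>p. g p (X p) (\<phi> p (Y p)))"
    using tensor02_smooth[OF tensor_g _ _ smooth_\<phi>] by blast
qed

end

section \<open>Legendre null curves\<close>

lemma velocity_reparam:
  assumes M: "smooth_manifold M" and C: "smooth_curve M I C" and h: "h s \<in> I" "h differentiable at s"
  shows "velocity M (C \<circ> h) s = deriv h s *\<^sub>R velocity M C (h s)"
proof
  fix f
  show "velocity M (C \<circ> h) s f = (deriv h s *\<^sub>R velocity M C (h s)) f"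
  proof (cases "smooth_near M (C (h s)) f")
    case True
    have "(h has_real_derivative deriv h s) (at s)"
      using h(2) by (simp add: DERIV_deriv_iff_real_differentiable)
    from DERIV_chain2[OF has_real_derivative_velocity[OF M C h(1) True] this]
    have "deriv (\<lambda>s. f (C (h s))) s = velocity M C (h s) f * deriv h s" by (rule DERIV_imp_deriv)
    then show ?thesis using True by (simp add: velocity_def)
  qed (simp add: velocity_def)
qed

text \<open>For the existence of an arc length parameter, which is a constant rescaling of the given
  one.\<close>

lemma smooth_curve_scale:
  assumes M: "smooth_manifold M" and C: "smooth_curve M I C" and r: "r > 0"
  shows "smooth_curve M {s. r * s \<in> I} (C \<circ> (\<lambda>s. r * s))"
  unfolding smooth_curve_def
proof (intro conjI ballI)
  let ?J = "{s. r * s \<in> I}" and ?h = "\<lambda>s. r * s"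
  have I: "open I" "is_interval I" "I \<noteq> {}" "continuous_map (top_of_set I) (mtop M) C"
    using C by (simp_all add: smooth_curve_def)
  have pre: "open {s. r * s \<in> A}" if "open A" for A
    using open_vimage[OF that continuous_on_mult_left[OF continuous_on_id], of r] by (simp add: vimage_def)
  show "open ?J" using I(1) by (rule pre)
  show "is_interval ?J"
    unfolding is_interval_1
  proof (intro ballI allI impI)
    fix x y z assume "x \<in> ?J" "y \<in> ?J" "x \<le> z \<and> z \<le> y"
    then show "z \<in> ?J"
      using r mem_is_interval_1_I[OF I(2), of "r * x" "r * y" "r * z"] by simp
  qed
  obtain x where "x \<in> I" using I(3) by blast
  then have "x / r \<in> ?J" using r by simp
  then show "?J \<noteq> {}" by blast
  have "continuous_map (top_of_set ?J) (top_of_set I) ?h"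
    by (auto intro: continuous_on_mult_left continuous_on_id)
  then show "continuous_map (top_of_set ?J) (mtop M) (C \<circ> ?h)"
    using I(4) by (rule continuous_map_compose)
  fix c assume c: "c \<in> atlas M"
  obtain D \<psi> where D: "c = (D, \<psi>)" by (cases c)
  let ?N = "{t \<in> I. C t \<in> D}"
  have N: "smooth_on ?N (\<lambda>t. \<psi> (C t))"
    using C c D unfolding smooth_curve_def comp_def by blast
  have "openin (mtop M) D" using M c D unfolding smooth_manifold_def by blast
  then have o: "open {s. r * s \<in> ?N}" using C by (intro pre open_curve_preimage)
  have "smooth_on {s. r * s \<in> ?N} (\<lambda>s. \<psi> (C (r * s)))"
    using o N smooth_on_linear[OF o bounded_linear_mult_right] by (rule smooth_on_compose) auto
  then show "case c of (D, \<psi>) \<Rightarrow> smooth_on {s \<in> ?J. (C \<circ> ?h) s \<in> D} (\<psi> \<circ> (C \<circ> ?h))"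
    by (simp add: D comp_def)
qed

context F4_manifold
begin

lemma tangent_space_span3:
  assumes "p \<in> points M"
  obtains B where "T p \<subseteq> span B" "finite B" "card B \<le> 3"
proof -
  obtain D \<psi> where "manifold_chart M D \<psi>" and D: "p \<in> D" using manifold_chart_at[OF manifold assms] .
  then interpret ch: manifold_chart M D \<psi> by simp
  show ?thesis
  proof (rule that)
    show "T p \<subseteq> span (range (\<lambda>i. ch.del i p))" using ch.tangent_space_eq_span[OF D] by simp
    show "card (range (\<lambda>i. ch.del i p)) \<le> 3" using card_image_le[of "UNIV :: 3 set"] by simp
  qed simp
qed

text \<open>The slant constant is any nonzero number and no speed is fixed, so that the result can
  be applied to the arc length parameterization itself.\<close>

lemma geodesic_of_legendre_null:
  assumes C: "smooth_curve M J C"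
    and null: "\<And>t. t \<in> J \<Longrightarrow> g (C t) (velocity M C t) (velocity M C t) = 0"
    and legendre: "\<And>t. t \<in> J \<Longrightarrow> \<eta> (C t) (velocity M C t) = 0"
    and slant: "\<And>t. t \<in> J \<Longrightarrow> g (C t) (velocity M C t) (\<phi> (C t) (velocity M C t)) = b" and b: "b \<noteq> 0"
  shows "geodesic M nabla' J C"
  unfolding geodesic_def
proof (intro conjI ballI impI C)
  fix t c assume t: "t \<in> J" and c: "c \<in> atlas M" "C t \<in> fst c"
  obtain D \<psi> where c': "c = (D, \<psi>)" by (cases c)
  have tD: "C t \<in> D" using c c' by simp
  interpret ch: manifold_chart M D \<psi> using c c' manifold by (simp add: manifold_chart_def)
  define p where "p = C t"
  define v where "v = velocity M C t"
  define X where "X = ch.const_field (ch.comps C t)"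
  define dv where "dv = ch.accel C t"
  define \<theta> where "\<theta> = lee_theta \<phi> g nabla ch.del \<xi> p"
  have pD: "p \<in> D" using tD by (simp add: p_def)
  have pM: "p \<in> points M" using pD ch.D_points by blast
  interpret contact_B_space "T p" "g p" "\<phi> p" "\<xi> p" "\<eta> p" by (rule contact_B_space[OF pM])
  have assoc: "associated_metric \<phi> \<eta> g p = gt" by (simp add: associated_metric_def gt_def fun_eq_iff)
  have Xp: "X p = v" using ch.velocity_eq_const_field[OF C t tD] by (simp add: X_def p_def v_def)
  have sX: "smooth_vfield_on M D X" unfolding X_def by (rule ch.smooth_vfield_const_field)
  have s\<xi>: "smooth_vfield_on M D \<xi>" using smooth_\<xi> ch.D_points by (rule smooth_vfield_on_subset)
  note s\<phi>X = smooth_\<phi>[OF ch.openin_D sX]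
  have v: "v \<in> T p" using smooth_vfield_in[OF sX pD] Xp by simp
  have dv: "dv \<in> T p" using ch.accel_in[of C t] tD by (simp add: dv_def p_def)
  \<comment> \<open>\<open>dv + n\<close> and \<open>dv + n'\<close> are the covariant derivatives
    of the velocity at \<open>t\<close> for \<open>nabla\<close> and \<open>nabla'\<close>. The
    products of \<open>dv + n\<close> with \<open>v\<close>, \<xi> and \<open>\<phi> v\<close> are
    determined in \<open>A1\<close>, \<open>A2\<close> and \<open>A3\<close>.\<close>
  define n where "n = nabla p v X"
  define n' where "n' = nabla' p v X"
  have n: "n \<in> T p" unfolding n_def by (rule nabla_in[OF affine ch.openin_D sX pD v])
  have n': "n' \<in> T p" unfolding n'_def by (rule nabla_in[OF affine' ch.openin_D sX pD v])
  have nphi: "nabla p v (\<lambda>q. \<phi> q (X q)) \<in> T p" by (rule nabla_in[OF affine ch.openin_D s\<phi>X pD v])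
  have vv: "g p v v = 0" "\<eta> p v = 0" "g p v (\<phi> p v) = b"
    using null[OF t] legendre[OF t] slant[OF t] by (simp_all add: p_def v_def)
  have v0: "v \<noteq> 0"
  proof
    assume "v = 0"
    then have "g p v (\<phi> p v) = 0" by simp
    then show False using vv b by simp
  qed
  have const: "d = 0" if "(f has_real_derivative d) (at t)" "\<And>s. s \<in> J \<Longrightarrow> f s = k" for f d k
  proof -
    have "(f has_real_derivative 0) (at t)"
      by (rule has_field_derivative_transform_within_open[OF DERIV_const[of k]])
        (use C t that in \<open>auto simp: smooth_curve_def\<close>)
    with that(1) show ?thesis by (rule DERIV_unique)
  qed
  have "g p dv v + g p v dv + v (\<lambda>q. g q (X q) (X q)) = 0"
    using const[OF ch.tensor02_curve_derivative[OF tensor_g C t tD] null]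
    by (simp add: p_def v_def dv_def X_def)
  moreover have "v (\<lambda>q. g q (X q) (X q)) = g p n v + g p v n"
    using metric_compatible[OF lc ch.openin_D sX sX sX pD] by (simp add: Xp n_def)
  \<comment> \<open>By symmetry of \<open>g\<close> the derivative of g(V, V) is twice this
    product.\<close>
  ultimately have A1: "g p (dv + n) v = 0"
    using g_sym[OF v dv] g_sym[OF v n] dv n v by (simp add: linear_simps)
  have "\<eta> p dv + v (\<lambda>q. \<eta> q (X q)) = 0"
    using const[OF ch.one_form_curve_derivative[OF form_\<eta> C t tD] legendre]
    by (simp add: p_def v_def dv_def X_def)
  \<comment> \<open>\<eta> is rewritten as g(., \<xi>) on the whole chart domain, so that metric
    compatibility brings in the derivative of \<xi>.\<close>
  moreover have "v (\<lambda>q. \<eta> q (X q)) = v (\<lambda>q. g q (X q) (\<xi> q))"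
    using manifold v ch.openin_D pD
  proof (rule tangent_vector_transform)
    fix q assume q: "q \<in> D"
    then have "q \<in> points M" using ch.D_points by blast
    from contact_B_space.g_\<xi>[OF contact_B_space[OF this] smooth_vfield_in[OF sX q]]
    show "\<eta> q (X q) = g q (X q) (\<xi> q)" by simp
  qed
  moreover have "v (\<lambda>q. g q (X q) (\<xi> q)) = g p n (\<xi> p) + g p v (nabla p v \<xi>)"
    using metric_compatible[OF lc ch.openin_D sX sX s\<xi> pD] by (simp add: Xp n_def)
  moreover have "g p v (nabla p v \<xi>) = \<theta> / 2 * b"
    using nabla_\<xi>[OF ch.openin_D ch.local_frame_del sX pD] vv by (simp add: Xp \<theta>_def)
  ultimately have A2: "\<eta> p (dv + n) = - (\<theta> / 2 * b)"
    using dv n by (simp add: linear_simps)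
  have "g p dv (\<phi> p v) + g p v (\<phi> p dv) + v (\<lambda>q. g q (X q) (\<phi> q (X q))) = 0"
    using const[OF ch.tensor02_curve_derivative[OF tensor_g\<phi> C t tD] slant]
    by (simp add: p_def v_def dv_def X_def)
  moreover have "v (\<lambda>q. g q (X q) (\<phi> q (X q))) = g p n (\<phi> p v) + g p v (nabla p v (\<lambda>q. \<phi> q (X q)))"
    using metric_compatible[OF lc ch.openin_D sX sX s\<phi>X pD] by (simp add: Xp n_def)
  \<comment> \<open>Both terms of the condition carry \<eta>(X) = 0. Hence \<phi> commutes with the
    derivative of \<open>X\<close> as far as the product with \<open>v\<close> is concerned.\<close>
  moreover have "F X X X p = 0"
    using F4[unfolded F4_condition_def] ch.openin_D ch.local_frame_del sX pD vv(2) Xp by auto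
  then have "g p v (nabla p v (\<lambda>q. \<phi> q (X q))) = g p n (\<phi> p v)"
    using n v nphi g_sym[OF v nphi]
    by (simp add: fundamental_F_def Xp linear_simps g_\<phi>_sym flip: n_def)
  moreover have "g p v (\<phi> p dv) = g p dv (\<phi> p v)"
    using g_sym[OF v \<phi>_in[OF dv]] g_\<phi>_sym[OF dv v] by simp
  ultimately have A3: "g p (dv + n) (\<phi> p v) = 0"
    using dv n v by (simp add: linear_simps)
  have "dv + n' = 0"
  proof (rule gt_nondegenerate)
    fix w assume w: "w \<in> T p"
    \<comment> \<open>\<open>nabla'_diagonal\<close> expects a field in its test slot, so
      \<open>w\<close> is extended with constant components.\<close>
    obtain d where d: "w = (\<Sum>i\<in>UNIV. d $ i *\<^sub>R ch.del i p)" using ch.tangent_spaceE[OF pD w] .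
    have Z: "ch.const_field d p = w" by (simp add: d ch.const_field_def)
    have "gt n' w = gt n w + \<theta> / 2 * b * \<eta> p w"
      using nabla'_diagonal[OF ch.openin_D ch.local_frame_del sX ch.smooth_vfield_const_field pD, of d] vv
      by (simp add: Xp Z assoc \<theta>_def n_def n'_def)
    moreover obtain B where B: "T p \<subseteq> span B" "finite B" "card B \<le> 3" using tangent_space_span3[OF pM] .
    have "gt (dv + n) w = \<eta> p (dv + n) * \<eta> p w"
      using orthogonal_null_legendre[OF v v0 vv(2) B _ A1 A3 w] dv n by simp
    ultimately show "gt (dv + n') w = 0"
      using dv n n' w by (simp add: A2 gt_linear)
  qed (use dv n' in simp)
  then show "cov_deriv_along M nabla' c C (velocity M C) t = 0"
    using ch.cov_deriv_along_eq[OF affine' C t tD]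
    by (simp add: c' dv_def n'_def p_def v_def X_def)
qed

end

text \<open>The first conjunct keeps the universal statement from being vacuous. The second covers
  every admissible arc length parameter, since these are determined only up to translation.\<close>

theorem theorem4p1:
  fixes M :: "('a, 3) manifold"
    and \<phi> :: "'a \<Rightarrow> 'a tvec \<Rightarrow> 'a tvec"
    and \<xi> :: "'a vfield"
    and \<eta> :: "'a \<Rightarrow> 'a tvec \<Rightarrow> real"
    and g :: "'a \<Rightarrow> 'a tvec \<Rightarrow> 'a tvec \<Rightarrow> real"
    and nabla nabla' :: "'a connection"
    and C :: "real \<Rightarrow> 'a"
    and I :: "real set"
    and a b :: real
  assumes "almost_contact_B_metric_manifold M \<phi> \<xi> \<eta> g"
    and "levi_civita M g nabla"
    and "levi_civita M (associated_metric \<phi> \<eta> g) nabla'"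
    and "F4_condition M \<phi> \<xi> \<eta> g nabla"
    and "null_curve M g I C"
    and "legendre_curve M \<eta> I C"
    and "phi_slant_curve M \<phi> \<xi> \<eta> g I C a b"
  shows "(\<exists>J h. arc_length_reparam M (associated_metric \<phi> \<eta> g) I C J h) \<and>
    (\<forall>J h. arc_length_reparam M (associated_metric \<phi> \<eta> g) I C J h \<longrightarrow>
       (b > 0 \<longrightarrow> spacelike_unit_curve M (associated_metric \<phi> \<eta> g) J (C \<circ> h)) \<and>
       (b < 0 \<longrightarrow> timelike_unit_curve M (associated_metric \<phi> \<eta> g) J (C \<circ> h)) \<and>
       legendre_curve M \<eta> J (C \<circ> h) \<and>
       (\<exists>a' b'. phi_slant_curve M \<phi> \<xi> \<eta> (associated_metric \<phi> \<eta> g) J (C \<circ> h) a' b') \<and>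
       geodesic M nabla' J (C \<circ> h))"
proof -
  interpret F4_manifold M \<phi> \<xi> \<eta> g nabla nabla' using assms(1-4) by unfold_locales
  have C: "smooth_curve M I C" using assms(5) by (simp add: null_curve_def)
  have null: "g (C t) (velocity M C t) (velocity M C t) = 0" "velocity M C t \<noteq> 0"
    and legendre: "\<eta> (C t) (velocity M C t) = 0"
    and slant: "g (C t) (velocity M C t) (\<phi> (C t) (velocity M C t)) = b" if "t \<in> I" for t
    using assms(5-7) that by (simp_all add: null_curve_def legendre_curve_def phi_slant_curve_def)
  have vel_in: "velocity M C t \<in> T (C t)" if "t \<in> I" for t
    using manifold C that by (rule velocity_in_tangent_space)
  have points: "C t \<in> points M" if "t \<in> I" for t using C that by (rule smooth_curve_in_points)
  have b: "b \<noteq> 0"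
  proof -
    obtain t where t: "t \<in> I" using C by (auto simp: smooth_curve_def)
    obtain B where B: "T (C t) \<subseteq> span B" "finite B" "card B \<le> 3"
      using tangent_space_span3[OF points[OF t]] .
    interpret contact_B_space "T (C t)" "g (C t)" "\<phi> (C t)" "\<xi> (C t)" "\<eta> (C t)"
      by (rule contact_B_space[OF points[OF t]])
    have "g (C t) (velocity M C t) (\<phi> (C t) (velocity M C t)) \<noteq> 0"
      by (rule null_legendre_nonzero[OF vel_in[OF t] null(2)[OF t] legendre[OF t] null(1)[OF t] B])
    then show ?thesis by (simp add: slant[OF t])
  qed
  \<comment> \<open>The products of the velocity scale with the square of h'. Since \<eta>(V) = 0,
    G(V, V) is g(V, \<phi> V) and G(V, \<phi> V) is -g(V, V) = 0.\<close>
  have reparam: "g (C (h s)) V V = 0 \<and> \<eta> (C (h s)) V = 0 \<and> g (C (h s)) V (\<phi> (C (h s)) V) = (deriv h s)\<^sup>2 * b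
      \<and> G (C (h s)) V V = (deriv h s)\<^sup>2 * b \<and> G (C (h s)) V (\<phi> (C (h s)) V) = 0
      \<and> G (C (h s)) V (\<xi> (C (h s))) = 0"
    if h: "h s \<in> I" "h differentiable at s" and V: "V = velocity M (C \<circ> h) s" for h s V
  proof -
    interpret contact_B_space "T (C (h s))" "g (C (h s))" "\<phi> (C (h s))" "\<xi> (C (h s))" "\<eta> (C (h s))"
      by (rule contact_B_space[OF points[OF h(1)]])
    have V': "V = deriv h s *\<^sub>R velocity M C (h s)"
      unfolding V by (rule velocity_reparam[OF manifold C h])
    show ?thesis
      unfolding V' associated_metric_def
      using vel_in[OF h(1)] null(1)[OF h(1)] legendre[OF h(1)] slant[OF h(1)]
      by (simp add: linear_simps \<phi>_\<phi> power2_eq_square)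
  qed
  have "arc_length_reparam M G I C {s. (1 / sqrt \<bar>b\<bar>) * s \<in> I} (\<lambda>s. (1 / sqrt \<bar>b\<bar>) * s)"
  proof -
    \<comment> \<open>Unit speed asks for (h')^2 |b| = 1, and \<open>r\<close> is the positive
      constant solution.\<close>
    define r where "r = 1 / sqrt \<bar>b\<bar>"
    have r: "r > 0" using b by (simp add: r_def)
    let ?J = "{s. r * s \<in> I}" and ?h = "\<lambda>s. r * s"
    have dh: "deriv ?h s = r" "?h differentiable at s" for s
      using DERIV_imp_deriv[OF DERIV_cmult_Id[of r]] by auto
    have sc: "smooth_curve M ?J (C \<circ> ?h)" using manifold C r by (rule smooth_curve_scale)
    have "bij_betw ?h ?J I"
      by (rule bij_betw_byWitness[where f' = "\<lambda>t. t / r"]) (use r in auto)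
    moreover have "smooth_on ?J ?h"
      using sc bounded_linear_mult_right by (intro smooth_on_linear) (auto simp: smooth_curve_def)
    moreover have "\<bar>G ((C \<circ> ?h) s) (velocity M (C \<circ> ?h) s) (velocity M (C \<circ> ?h) s)\<bar> = 1" if "s \<in> ?J" for s
    proof -
      have "G (C (r * s)) (velocity M (C \<circ> ?h) s) (velocity M (C \<circ> ?h) s) = r\<^sup>2 * b"
        using reparam[of ?h s] dh that by simp
      moreover have "r\<^sup>2 * \<bar>b\<bar> = 1" using b by (simp add: r_def power_divide)
      ultimately show ?thesis by (simp add: abs_mult)
    qed
    ultimately show ?thesis
      using sc r dh unfolding arc_length_reparam_def unit_speed_curve_def r_def[symmetric]
      by (simp add: smooth_curve_def)
  qed
  moreover have "(b > 0 \<longrightarrow> spacelike_unit_curve M G J (C \<circ> h)) \<and>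
       (b < 0 \<longrightarrow> timelike_unit_curve M G J (C \<circ> h)) \<and>
       legendre_curve M \<eta> J (C \<circ> h) \<and>
       (\<exists>a' b'. phi_slant_curve M \<phi> \<xi> \<eta> G J (C \<circ> h) a' b') \<and>
       geodesic M nabla' J (C \<circ> h)"
    if h: "arc_length_reparam M G I C J h" for J h
  proof -
    have Ch: "smooth_curve M J (C \<circ> h)"
      and unit: "\<And>s. s \<in> J \<Longrightarrow> \<bar>G ((C \<circ> h) s) (velocity M (C \<circ> h) s) (velocity M (C \<circ> h) s)\<bar> = 1"
      using h by (auto simp: arc_length_reparam_def unit_speed_curve_def)
    have hI: "h s \<in> I" "h differentiable at s" if "s \<in> J" for s
      using h that smooth_on_differentiable
      by (auto simp: arc_length_reparam_def bij_betw_def)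
    note V = reparam[OF hI refl]
    \<comment> \<open>Unit speed fixes (h')^2 |b| = 1, so only the sign of \<open>b\<close> is left;
      it decides between spacelike and timelike.\<close>
    have sq: "(deriv h s)\<^sup>2 * b = sgn b" if "s \<in> J" for s
    proof -
      have "(deriv h s)\<^sup>2 * \<bar>b\<bar> = 1" using unit[OF that] V[OF that that] by (simp add: abs_mult)
      then show ?thesis using b by (auto simp: sgn_if abs_if split: if_splits)
    qed
    \<comment> \<open>\<open>C \<circ> h\<close> is again null and Legendre for \<open>g\<close>,
      with slant constant \<open>sgn b\<close>, so the lemma applies to it directly instead of
      transporting the geodesic equation through \<open>h\<close>.\<close>
    have "geodesic M nabla' J (C \<circ> h)"
      by (rule geodesic_of_legendre_null[OF Ch, where b = "sgn b"])
        (use V sq b in \<open>auto simp: sgn_zero_iff\<close>)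
    moreover have "phi_slant_curve M \<phi> \<xi> \<eta> G J (C \<circ> h) 0 0"
      using V by (simp add: phi_slant_curve_def)
    ultimately show ?thesis
      using Ch V sq by (auto simp: spacelike_unit_curve_def timelike_unit_curve_def legendre_curve_def)
  qed
  ultimately show ?thesis by blast
qed

end
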